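(* Let $G$ be a countable group and let $X$ be an infinite-dimensional separable real Banach space which contains a complemented subspace with a symmetric basis. Then $\{-1,1\}\times G$ is representable in $X$.
   Context: A group $H$ is representable in a Banach space $X$ if there exists an equivalent norm on $X$ for which the group of isometries on $X$ (all surjective linear isometries of $X$ onto itself) is isomorphic, as a group, to $H$. Countable means finite or countably infinite. A symmetric basis is understood to be an infinite basis $(s_n)_{n\in\mathbb{N}}$ which is symmetric in the usual sense. $\{-1,1\}$ is the multiplicative group with two elements. *)

theory Defs
  imports "HOL-Analysis.Analysis" "HOL-Algebra.Sym_Groups"
begin

definition is_norm :: "('a::real_vector \<Rightarrow> real) \<Rightarrow> bool" where
  "is_norm N \<longleftrightarrow>
     (\<forall>x. N x = 0 \<longleftrightarrow> x = 0) \<and>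
     (\<forall>c x. N (c *\<^sub>R x) = \<bar>c\<bar> * N x) \<and>
     (\<forall>x y. N (x + y) \<le> N x + N y)"

definition equivalent_norm :: "('a::real_normed_vector \<Rightarrow> real) \<Rightarrow> bool" where
  "equivalent_norm N \<longleftrightarrow>
     is_norm N \<and> (\<exists>c>0. \<exists>C>0. \<forall>x. c * norm x \<le> N x \<and> N x \<le> C * norm x)"

definition isometry_group :: "('a::real_vector \<Rightarrow> real) \<Rightarrow> ('a \<Rightarrow> 'a) monoid" where
  "isometry_group N =
     \<lparr> carrier = {T. linear T \<and> surj T \<and> (\<forall>x. N (T x) = N x)}, mult = (\<circ>), one = id \<rparr>"

(* The space X is the whole type 'a, passed as TYPE('a). *)
definition representable :: "('g, 'm) monoid_scheme \<Rightarrow> 'a::real_normed_vector itself \<Rightarrow> bool" where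
  "representable H X \<longleftrightarrow>
     (\<exists>N :: 'a \<Rightarrow> real. equivalent_norm N \<and> isometry_group N \<cong> H)"

definition infinite_dimensional :: "'a::real_vector itself \<Rightarrow> bool" where
  "infinite_dimensional X \<longleftrightarrow> \<not> (\<exists>B :: 'a set. finite B \<and> span B = UNIV)"

definition complemented_subspace :: "'a::real_normed_vector set \<Rightarrow> bool" where
  "complemented_subspace Y \<longleftrightarrow>
     subspace Y \<and> closed Y \<and> (\<exists>P. bounded_linear P \<and> P \<circ> P = P \<and> range P = Y)"

definition schauder_basis :: "(nat \<Rightarrow> 'a::real_normed_vector) \<Rightarrow> 'a set \<Rightarrow> bool" where
  "schauder_basis s Y \<longleftrightarrow>
     range s \<subseteq> Y \<and> (\<forall>y\<in>Y. \<exists>!a :: nat \<Rightarrow> real. (\<lambda>n. a n *\<^sub>R s n) sums y)"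

definition equivalent_sequences ::
    "(nat \<Rightarrow> 'a::real_normed_vector) \<Rightarrow> (nat \<Rightarrow> 'a) \<Rightarrow> bool" where
  "equivalent_sequences s t \<longleftrightarrow>
     (\<forall>a :: nat \<Rightarrow> real. summable (\<lambda>n. a n *\<^sub>R s n) \<longleftrightarrow> summable (\<lambda>n. a n *\<^sub>R t n))"

(* Symmetric in the sense of Lindenstrauss and Tzafriri: every permutation of the basis is a
   basis equivalent to it.  No symmetry constant equal to 1 is required. *)
definition symmetric_basis :: "(nat \<Rightarrow> 'a::real_normed_vector) \<Rightarrow> 'a set \<Rightarrow> bool" where
  "symmetric_basis s Y \<longleftrightarrow>
     schauder_basis s Y \<and>
     (\<forall>\<pi>. bij \<pi> \<longrightarrow> schauder_basis (s \<circ> \<pi>) Y \<and> equivalent_sequences (s \<circ> \<pi>) s)"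

end

theory Submission
  imports Defs
begin

text \<open>Let \<open>P\<close> be the projection onto the subspace with symmetric basis \<open>s\<close>. Every permutation of the
basis extends to an operator on the whole space that is the identity on the kernel of \<open>P\<close>, and a
gliding hump shows that these operators are uniformly bounded (\<open>permutation_bound\<close>). Index the
basis by \<open>G \<times> \<nat>\<close> together with two more indices, and let \<open>G\<close> act by left translation on the first
factor. This gives a bounded action \<open>T\<close> of \<open>G\<close> on the space, with basis vectors \<open>e (g, n)\<close>
permuted freely and two basis vectors \<open>p\<close>, \<open>q\<close> fixed. It remains to find an equivalent norm whose
isometries are exactly the maps \<open>\<plusminus> T g\<close>.

The norm is the gauge of the convex hull of a bounded \<open>G\<close>-invariant set \<open>S\<close> containing a ball. A point
of the unit sphere is called sharp if the ball lies in a cone with apex there. The set \<open>S\<close> consists of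
three kinds of points.

\<^item> The spikes \<open>\<plusminus> e (g, n)\<close>. They are sharp with constant \<open>1/20\<close>, and are the only such points.

\<^item> The links, positive multiples of \<open>e (h, 0) + e (h g, n + 1)\<close> with a factor that depends only on
  \<open>(g, n)\<close> and determines it. They are rotated in the plane of \<open>p\<close> and \<open>q\<close>, so that every one of them lies in
  the interior of an elliptic arc and none is sharp. The same is done to a ball around the origin.

\<^item> The bonds \<open>3/4 (e (h, 0) - e (h, n + 1)) + w n\<close>, where the \<open>w n\<close> are fixed by \<open>G\<close> and,
  together with the spikes, span a dense subspace. A bond is sharp, but only barely, because it
  protrudes very little from an arc.

An isometry preserves sharpness, so it permutes the spikes. It preserves the norm of the sum of two
spikes, which for linked spikes is the reciprocal of the factor and lies outside the range of all
other values (\<open>decode_link\<close>). It thus acts on the spikes as an automorphism of a graph with edges coloured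
by \<open>G \<times> \<nat>\<close>, and such an automorphism is determined by the image of \<open>e (1, 0)\<close>, which has to be some
\<open>\<plusminus> e (g, 0)\<close>. After composition with \<open>\<plusminus> T g\<inverse>\<close> all spikes are fixed. Each bond is then moved by
little, and since it is an isolated sharp point it is not moved at all. So the \<open>w n\<close> are fixed as well and
the isometry is the identity (\<open>isometry_fixing_base\<close>).\<close>

section \<open>Gauge norms and sharp points\<close>

definition atomic_norm :: "'a::real_normed_vector set \<Rightarrow> 'a \<Rightarrow> real" where
  "atomic_norm S x = Inf {t. 0 \<le> t \<and> (\<exists>c\<in>convex hull S. x = t *\<^sub>R c)}"

text \<open>The functional \<open>f\<close> supports the unit ball at \<open>u\<close> and the ball stays inside a cone with apex \<open>u\<close> whose
opening is measured by \<open>c\<close>. The definition refers to nothing but the norm and the linear structure, which is why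
isometries preserve it.\<close>

definition sharp :: "('a::real_vector \<Rightarrow> real) \<Rightarrow> real \<Rightarrow> 'a \<Rightarrow> bool" where
  "sharp N c u \<longleftrightarrow> N u = 1 \<and>
     (\<exists>f. linear f \<and> f u = 1 \<and> (\<forall>x. N x \<le> 1 \<longrightarrow> f x \<le> 1 - c * N (x - u)))"

locale atoms =
  fixes S :: "'a::real_normed_vector set" and r R :: real
  assumes sym: "s \<in> S \<Longrightarrow> - s \<in> S"
    and r_pos: "0 < r"
    and ball: "norm x \<le> r \<Longrightarrow> x \<in> S"
    and bounded: "s \<in> S \<Longrightarrow> norm s \<le> R"
begin

abbreviation N where "N \<equiv> atomic_norm S"

lemma R_pos: "0 < R" if "(x::'a) \<noteq> 0"
proof -
  have "norm ((r / norm x) *\<^sub>R x) = r" using that r_pos by simp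
  then show ?thesis using bounded[OF ball, of "(r / norm x) *\<^sub>R x"] r_pos by simp
qed

lemma hull_bounded: "c \<in> convex hull S \<Longrightarrow> norm c \<le> R"
proof -
  have "convex hull S \<subseteq> cball 0 R"
    by (rule hull_minimal) (auto simp: bounded)
  then show "c \<in> convex hull S \<Longrightarrow> norm c \<le> R" by auto
qed

lemma zero_in_hull: "0 \<in> convex hull S"
  using ball[of 0] r_pos by (auto intro: hull_inc)

lemma hull_shrink: "c \<in> convex hull S \<Longrightarrow> 0 \<le> t \<Longrightarrow> t \<le> 1 \<Longrightarrow> t *\<^sub>R c \<in> convex hull S"
  using convexD_alt[OF convex_convex_hull zero_in_hull, of c t] by simp

lemma hull_uminus: "c \<in> convex hull S \<Longrightarrow> - c \<in> convex hull S"
proof -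
  have "linear (uminus :: 'a \<Rightarrow> 'a)" by (rule linearI) auto
  then have "convex {x. - x \<in> convex hull S}"
    using convex_linear_vimage[of uminus "convex hull S"] convex_convex_hull
    by (auto simp: vimage_def)
  then have "convex hull S \<subseteq> {x. - x \<in> convex hull S}"
    by (intro hull_minimal) (auto simp: sym hull_inc)
  then show "c \<in> convex hull S \<Longrightarrow> - c \<in> convex hull S" by auto
qed

lemma scales_bdd_below: "bdd_below {t. 0 \<le> t \<and> (\<exists>c\<in>convex hull S. x = t *\<^sub>R c)}"
  by (rule bdd_belowI[of _ 0]) auto

lemma representation: "\<exists>c\<in>convex hull S. x = (norm x / r) *\<^sub>R c"
proof (rule bexI)
  show "(r / norm x) *\<^sub>R x \<in> convex hull S"
    using r_pos by (cases "x = 0") (auto intro!: hull_inc ball)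
qed (use r_pos in auto)

lemma N_le_norm: "N x \<le> norm x / r"
  unfolding atomic_norm_def
  by (rule cInf_lower[OF _ scales_bdd_below]) (use representation[of x] r_pos in auto)

lemma N_lessD:
  assumes "N x < t"
  obtains t' c where "0 \<le> t'" "t' < t" "c \<in> convex hull S" "x = t' *\<^sub>R c"
proof -
  have ne: "{t. 0 \<le> t \<and> (\<exists>c\<in>convex hull S. x = t *\<^sub>R c)} \<noteq> {}"
    using representation[of x] r_pos by (auto intro!: exI[of _ "norm x / r"])
  show ?thesis
    using cInf_lessD[OF ne assms[unfolded atomic_norm_def]] that by blast
qed

lemma N_leI: "0 \<le> t \<Longrightarrow> c \<in> convex hull S \<Longrightarrow> N (t *\<^sub>R c) \<le> t"
  unfolding atomic_norm_def by (rule cInf_lower[OF _ scales_bdd_below]) auto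

lemma N_hull: "c \<in> convex hull S \<Longrightarrow> N c \<le> 1"
  using N_leI[of 1 c] by simp

lemma N_atom: "s \<in> S \<Longrightarrow> N s \<le> 1"
  by (simp add: N_hull hull_inc)

lemma N_nonneg: "0 \<le> N x"
proof (rule ccontr)
  assume "\<not> 0 \<le> N x"
  then show False using N_lessD[of x 0] by force
qed

lemma norm_le_N: "norm x \<le> R * N x"
proof (cases "x = 0")
  case True then show ?thesis
    using N_leI[of 0 0] zero_in_hull N_nonneg[of 0] by simp
next
  case False
  have "norm x / R \<le> N x"
  proof (rule field_le_epsilon)
    fix e :: real assume "0 < e"
    then obtain t c where tc: "0 \<le> t" "t < N x + e" "c \<in> convex hull S" "x = t *\<^sub>R c"
      using N_lessD[of x "N x + e"] by auto
    have "norm x \<le> t * R" using tc hull_bounded[of c] by (simp add: mult_left_mono)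
    then have "norm x / R \<le> t" using R_pos[OF False] by (simp add: field_simps)
    then show "norm x / R \<le> N x + e" using tc by simp
  qed
  then show ?thesis using R_pos[OF False] by (simp add: field_simps)
qed

lemma N_zero_iff: "N x = 0 \<longleftrightarrow> x = 0"
  using norm_le_N[of x] N_leI[of 0 0] zero_in_hull N_nonneg[of 0] by (cases "x = 0") auto

lemma N_scale_le: "N (a *\<^sub>R x) \<le> \<bar>a\<bar> * N x"
proof (rule field_le_epsilon)
  fix e :: real assume e: "0 < e"
  define d where "d = e / (\<bar>a\<bar> + 1)"
  have d: "d > 0" "\<bar>a\<bar> * d \<le> e"
    using e by (auto simp: d_def field_simps)
  then obtain t c where tc: "0 \<le> t" "t < N x + d" "c \<in> convex hull S" "x = t *\<^sub>R c"
    using N_lessD[of x "N x + d"] by auto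
  have "N ((\<bar>a\<bar> * t) *\<^sub>R (if a \<ge> 0 then c else - c)) \<le> \<bar>a\<bar> * t"
    by (rule N_leI) (use tc hull_uminus in auto)
  moreover have "(\<bar>a\<bar> * t) *\<^sub>R (if a \<ge> 0 then c else - c) = a *\<^sub>R x"
    using tc by auto
  moreover have "\<bar>a\<bar> * t \<le> \<bar>a\<bar> * (N x + d)" using tc by (intro mult_left_mono) auto
  ultimately show "N (a *\<^sub>R x) \<le> \<bar>a\<bar> * N x + e"
    using d by (simp add: algebra_simps)
qed

lemma N_scale: "N (a *\<^sub>R x) = \<bar>a\<bar> * N x"
proof (cases "a = 0")
  case True then show ?thesis using N_zero_iff[of 0] by simp
next
  case False
  have "N x = N (inverse a *\<^sub>R (a *\<^sub>R x))" using False by simp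
  also have "\<dots> \<le> \<bar>inverse a\<bar> * N (a *\<^sub>R x)" by (rule N_scale_le)
  finally have "\<bar>a\<bar> * N x \<le> N (a *\<^sub>R x)" using False by (simp add: field_simps)
  then show ?thesis using N_scale_le[of a x] by simp
qed

lemma N_triangle: "N (x + y) \<le> N x + N y"
proof (rule field_le_epsilon)
  fix e :: real assume e: "0 < e"
  obtain t c where tc: "0 \<le> t" "t < N x + e/2" "c \<in> convex hull S" "x = t *\<^sub>R c"
    using N_lessD[of x "N x + e/2"] e by auto
  obtain t' c' where tc': "0 \<le> t'" "t' < N y + e/2" "c' \<in> convex hull S" "y = t' *\<^sub>R c'"
    using N_lessD[of y "N y + e/2"] e by auto
  show "N (x + y) \<le> N x + N y + e"
  proof (cases "t + t' = 0")
    case True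
    then have "x = 0" "y = 0" using tc tc' by auto
    then show ?thesis using N_zero_iff[of 0] e by simp
  next
    case False
    define d where "d = (t / (t + t')) *\<^sub>R c + (t' / (t + t')) *\<^sub>R c'"
    have "d \<in> convex hull S" unfolding d_def
      by (rule convexD[OF convex_convex_hull]) (use tc tc' False in \<open>auto simp: add_divide_distrib[symmetric]\<close>)
    moreover have "(t + t') *\<^sub>R d = x + y"
      using False tc tc' by (simp add: d_def scaleR_add_right)
    ultimately have "N (x + y) \<le> t + t'" using N_leI[of "t + t'" d] tc tc' by simp
    then show ?thesis using tc tc' by simp
  qed
qed

lemma N_uminus: "N (- x) = N x"
  using N_scale[of "-1" x] by simp

lemma N_minus_commute: "N (x - y) = N (y - x)"
  using N_uminus[of "x - y"] by simp

lemma N_triangle_diff: "N (x - z) \<le> N (x - y) + N (y - z)"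
  using N_triangle[of "x - y" "y - z"] by simp

lemma equivalent_norm_N: "equivalent_norm N"
proof -
  have "is_norm N" unfolding is_norm_def using N_zero_iff N_scale N_triangle by blast
  moreover have "\<exists>c>0. \<exists>C>0. \<forall>x. c * norm x \<le> N x \<and> N x \<le> C * norm x"
  proof (intro exI conjI allI)
    let ?R = "max R 1"
    show "0 < 1 / ?R" "0 < 1 / r" using r_pos by auto
    fix x :: 'a
    have "norm x \<le> ?R * N x"
      using norm_le_N[of x] N_nonneg[of x] mult_right_mono[of R ?R "N x"] by linarith
    then show "1 / ?R * norm x \<le> N x" by (simp add: field_simps)
    show "N x \<le> 1 / r * norm x" using N_le_norm[of x] by simp
  qed
  ultimately show ?thesis unfolding equivalent_norm_def by blast
qed

text \<open>Dual description of the gauge: a linear functional is bounded by its supremum over the atoms. All lower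
estimates of the norm below come from this.\<close>

lemma functional_le_N:
  fixes f :: "'a \<Rightarrow> real"
  assumes f: "linear f" and b: "0 \<le> b" "\<And>s. s \<in> S \<Longrightarrow> f s \<le> b"
  shows "\<bar>f x\<bar> \<le> b * N x"
proof -
  have hull: "f c \<le> b" if "c \<in> convex hull S" for c
  proof -
    have "convex {x. f x \<le> b}"
      using convex_linear_vimage[OF f, of "{..b}"] by (simp add: vimage_def)
    then have "convex hull S \<subseteq> {x. f x \<le> b}" by (intro hull_minimal) (auto simp: b)
    then show ?thesis using that by auto
  qed
  have le: "f y \<le> b * N y" for y
  proof (rule field_le_epsilon)
    fix e :: real assume e: "0 < e"
    define d where "d = e / (b + 1)"
    have d: "d > 0" "b * d \<le> e" using e b by (auto simp: d_def field_simps)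
    then obtain t c where tc: "0 \<le> t" "t < N y + d" "c \<in> convex hull S" "y = t *\<^sub>R c"
      using N_lessD[of y "N y + d"] by auto
    have "f y = t * f c" using tc linear_scale[OF f] by simp
    also have "\<dots> \<le> t * b" using hull tc by (simp add: mult_left_mono)
    also have "\<dots> \<le> (N y + d) * b" using tc b by (intro mult_right_mono) auto
    finally show "f y \<le> b * N y + e" using d by (simp add: algebra_simps)
  qed
  show ?thesis using le[of x] le[of "- x"] by (simp add: linear_neg[OF f] N_uminus)
qed

text \<open>The convex hull need not be closed, so points of the unit ball are only approximated by it, in the
gauge norm itself.\<close>

lemma N_approx_hull:
  assumes "N x \<le> 1" "0 < e"
  obtains c where "c \<in> convex hull S" "N (x - c) \<le> e"
proof -
  obtain t c where tc: "0 \<le> t" "t < 1 + e" "c \<in> convex hull S" "x = t *\<^sub>R c"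
    using N_lessD[of x "1 + e"] assms by auto
  show ?thesis
  proof (cases "t \<le> 1")
    case True
    then have "x \<in> convex hull S" using tc hull_shrink by simp
    then show ?thesis using that[of x] assms N_zero_iff[of 0] by simp
  next
    case False
    have "x - c = (t - 1) *\<^sub>R c" using tc by (simp add: scaleR_diff_left)
    then have "N (x - c) = (t - 1) * N c" using False N_scale by simp
    also have "\<dots> \<le> (t - 1) * 1" using False N_hull tc by (intro mult_left_mono) auto
    finally show ?thesis using that[of c] tc by simp
  qed
qed

lemma N_linear_image_le:
  assumes T: "linear T" and "T ` S \<subseteq> S"
  shows "N (T x) \<le> N x"
proof (rule field_le_epsilon)
  fix e :: real assume "0 < e"
  then obtain t c where tc: "0 \<le> t" "t < N x + e" "c \<in> convex hull S" "x = t *\<^sub>R c"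
    using N_lessD[of x "N x + e"] by auto
  have "T c \<in> convex hull (T ` S)" using convex_hull_linear_image[OF T, of S] tc by blast
  then have "T c \<in> convex hull S" using hull_mono[OF assms(2)] by blast
  then have "N (t *\<^sub>R T c) \<le> t" using N_leI tc by blast
  then show "N (T x) \<le> N x + e" using tc linear_scale[OF T] by simp
qed

lemma sharp_functional_le:
  assumes "linear f" "c \<ge> 0" "\<And>x. N x \<le> 1 \<Longrightarrow> f x \<le> 1 - c * N (x - u)"
  shows "\<bar>f x\<bar> \<le> N x"
proof -
  have "f s \<le> 1" if "s \<in> S" for s
    using assms(3)[OF N_atom[OF that]] mult_nonneg_nonneg[OF assms(2) N_nonneg[of "s - u"]] by linarith
  then show ?thesis using functional_le_N[OF assms(1), of 1 x] by simp
qed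

text \<open>If \<open>f\<close> separates the atom \<open>u\<close> from all other atoms by a gap, then moving away from \<open>u\<close> inside the hull
means putting weight on atoms with smaller \<open>f\<close>. In formulas, \<open>x \<mapsto> f x + c * N (x - u)\<close> is convex
and at most 1 at every atom.\<close>

lemma isolated_atom_sharp:
  assumes f: "linear f" and u: "u \<in> S" "f u = 1"
    and c: "0 \<le> c" "c \<le> 1/2" and gap: "\<And>s. s \<in> S \<Longrightarrow> s \<noteq> u \<Longrightarrow> f s \<le> 1 - 2 * c"
  shows "sharp N c u"
proof -
  have f1: "f s \<le> 1" if "s \<in> S" for s using gap[OF that] u c by (cases "s = u") auto
  have fN: "\<bar>f x\<bar> \<le> N x" for x using functional_le_N[OF f, of 1 x] f1 by simp
  have "N u = 1" using fN[of u] u N_atom[of u] by simp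
  have hull: "f x + c * N (x - u) \<le> 1" if "x \<in> convex hull S" for x
  proof -
    have "convex {x. f x + c * N (x - u) \<le> 1}"
    proof (rule convexI)
      fix x y :: 'a and a b :: real
      assume *: "x \<in> {x. f x + c * N (x - u) \<le> 1}" "y \<in> {x. f x + c * N (x - u) \<le> 1}"
        and ab: "0 \<le> a" "0 \<le> b" "a + b = 1"
      have "a *\<^sub>R x + b *\<^sub>R y - u = a *\<^sub>R (x - u) + b *\<^sub>R (y - u)"
        using ab by (simp add: algebra_simps scaleR_add_left[symmetric] del: scaleR_add_left)
      then have "N (a *\<^sub>R x + b *\<^sub>R y - u) \<le> a * N (x - u) + b * N (y - u)"
        using N_triangle[of "a *\<^sub>R (x - u)" "b *\<^sub>R (y - u)"] ab by (simp add: N_scale)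
      then have "c * N (a *\<^sub>R x + b *\<^sub>R y - u) \<le> c * (a * N (x - u) + b * N (y - u))"
        using c by (intro mult_left_mono)
      then have "f (a *\<^sub>R x + b *\<^sub>R y) + c * N (a *\<^sub>R x + b *\<^sub>R y - u)
          \<le> a * (f x + c * N (x - u)) + b * (f y + c * N (y - u))"
        by (simp add: linear_add[OF f] linear_scale[OF f] algebra_simps)
      also have "\<dots> \<le> a * 1 + b * 1" using * ab by (intro add_mono mult_left_mono) auto
      finally show "a *\<^sub>R x + b *\<^sub>R y \<in> {x. f x + c * N (x - u) \<le> 1}" using ab by simp
    qed
    moreover have "f s + c * N (s - u) \<le> 1" if "s \<in> S" for s
    proof (cases "s = u")
      case True then show ?thesis using u N_zero_iff[of 0] by simp
    next
      case False
      have "N (s - u) \<le> 2" using N_triangle[of s "- u"] N_atom[OF that] N_atom[OF u(1)] N_uminus[of u] by simp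
      then have "c * N (s - u) \<le> c * 2" using c by (intro mult_left_mono)
      then show ?thesis using gap[OF that False] by simp
    qed
    ultimately have "convex hull S \<subseteq> {x. f x + c * N (x - u) \<le> 1}" by (intro hull_minimal) auto
    then show ?thesis using that by auto
  qed
  have "f x \<le> 1 - c * N (x - u)" if x: "N x \<le> 1" for x
  proof (rule field_le_epsilon)
    fix e :: real assume e: "0 < e"
    obtain y where y: "y \<in> convex hull S" "N (x - y) \<le> e / 2" using N_approx_hull[OF x, of "e/2"] e by auto
    have "f x = f y + f (x - y)" by (simp add: linear_diff[OF f])
    moreover have "f (x - y) \<le> e / 2" using fN[of "x - y"] y by linarith
    moreover have "c * N (x - u) \<le> c * (N (y - u) + N (x - y))"
      using N_triangle_diff[of x u y] c by (intro mult_left_mono) auto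
    moreover have "c * N (x - y) \<le> 1 * (e / 2)" using c y N_nonneg by (intro mult_mono) auto
    ultimately show "f x \<le> 1 - c * N (x - u) + e" using hull[OF y(1)] by (simp add: algebra_simps)
  qed
  then show ?thesis unfolding sharp_def using \<open>N u = 1\<close> f u by blast
qed

text \<open>A kind of Milman theorem: a point of the hull at which the supporting functional is nearly 1 must use an
atom with the same property, and by sharpness that atom is close to \<open>u\<close>.\<close>

lemma sharp_near_atom:
  assumes "sharp N c u" "0 < c" "0 < e"
  obtains s where "s \<in> S" "N (s - u) \<le> e"
proof -
  obtain f where f: "linear f" "f u = 1" "\<And>x. N x \<le> 1 \<Longrightarrow> f x \<le> 1 - c * N (x - u)" and u: "N u = 1"
    using assms(1) unfolding sharp_def by blast
  have fN: "\<bar>f x\<bar> \<le> N x" for x using sharp_functional_le[OF f(1) _ f(3)] assms by simp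
  have "c * e > 0" using assms by simp
  then obtain y where y: "y \<in> convex hull S" "N (u - y) \<le> c * e" using N_approx_hull[of u "c*e"] u by auto
  have "\<exists>s\<in>S. 1 - c * e \<le> f s"
  proof (rule ccontr)
    assume "\<not> ?thesis"
    moreover have "convex {x. f x < 1 - c * e}"
      using convex_linear_vimage[OF f(1), of "{..<1 - c * e}"] by (simp add: vimage_def)
    ultimately have "convex hull S \<subseteq> {x. f x < 1 - c * e}" by (intro hull_minimal) auto
    then have "f y < 1 - c * e" using y by auto
    moreover have "f u = f y + f (u - y)" by (simp add: linear_diff[OF f(1)])
    ultimately show False using fN[of "u - y"] f(2) y by linarith
  qed
  then obtain s where s: "s \<in> S" "1 - c * e \<le> f s" by blast
  have "c * N (s - u) \<le> c * e" using f(3)[OF N_atom[OF s(1)]] s by linarith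
  then show ?thesis using that[OF s(1)] assms by simp
qed

text \<open>If \<open>s\<close> is the midpoint of an elliptic arc inside the ball, then the supporting functional
of a nearby sharp point would drop linearly along both halves of the arc, while a linear functional on an
ellipse has a vanishing first-order symmetric difference.\<close>

lemma sharp_far_from_arcs:
  assumes u: "sharp N c u" "0 \<le> c" and \<eta>: "N (s - u) \<le> \<eta>" and \<nu>: "0 \<le> \<nu>" "\<nu> \<le> N w"
    and arc: "\<And>a b. a\<^sup>2 + b\<^sup>2 = 1 \<Longrightarrow> N (a *\<^sub>R s + b *\<^sub>R w) \<le> 1"
  shows "c\<^sup>2 * \<nu>\<^sup>2 \<le> 2 * \<eta>"
proof -
  obtain f where f: "linear f" "f u = 1" "\<And>x. N x \<le> 1 \<Longrightarrow> f x \<le> 1 - c * N (x - u)"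
    using u(1) unfolding sharp_def by blast
  have fN: "\<bar>f x\<bar> \<le> N x" for x using sharp_functional_le[OF f(1) _ f(3)] u(2) by simp
  (* (a, b) is the rational point of the unit circle with parameter \<tau>. The estimate obtained for a general
   parameter is 2 * \<tau> * c * \<nu> \<le> 2 * \<tau>^2 + \<eta>, and this value of \<tau> optimises it. *)
  define \<tau> where "\<tau> = c * \<nu> / 2"
  define a where "a = (1 - \<tau>\<^sup>2) / (1 + \<tau>\<^sup>2)"
  define b where "b = 2 * \<tau> / (1 + \<tau>\<^sup>2)"
  have pos: "1 + \<tau>\<^sup>2 > 0" by (smt (verit) zero_le_power2)
  have \<tau>: "0 \<le> \<tau>" using u \<nu> by (simp add: \<tau>_def)
  have b0: "0 \<le> b" using \<tau> pos by (simp add: b_def)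
  have ab: "a\<^sup>2 + b\<^sup>2 = 1"
  proof -
    have "(1 - \<tau>\<^sup>2)\<^sup>2 + (2 * \<tau>)\<^sup>2 = (1 + \<tau>\<^sup>2)\<^sup>2" by (simp add: power2_eq_square algebra_simps)
    then show ?thesis using pos by (simp add: a_def b_def power_divide add_divide_distrib[symmetric])
  qed
  let ?x = "a *\<^sub>R s + b *\<^sub>R w" and ?y = "a *\<^sub>R s + (- b) *\<^sub>R w"
  have fx: "f ?x \<le> 1 - c * N (?x - u)" using f(3)[OF arc[OF ab]] .
  have fy: "f ?y \<le> 1 - c * N (?y - u)" using f(3)[OF arc[of a "- b"]] ab by simp
  have "N (?x - ?y) \<le> N (?x - u) + N (?y - u)"
    using N_triangle_diff[of ?x ?y u] N_minus_commute[of u ?y] by simp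
  moreover have "N (?x - ?y) = 2 * b * N w"
  proof -
    have "?x - ?y = (2 * b) *\<^sub>R w" by (simp add: scaleR_add_left[symmetric])
    then show ?thesis using N_scale[of "2 * b" w] b0 by simp
  qed
  moreover have "2 * b * \<nu> \<le> 2 * b * N w" using \<nu> b0 by (intro mult_left_mono) auto
  ultimately have "2 * b * \<nu> \<le> N (?x - u) + N (?y - u)" by linarith
  then have "c * (2 * b * \<nu>) \<le> c * (N (?x - u) + N (?y - u))" using u(2) by (rule mult_left_mono)
  moreover have "f ?x + f ?y = 2 * (a * f s)"
    by (simp only: linear_add[OF f(1)] linear_scale[OF f(1)]) (simp add: algebra_simps)
  ultimately have main: "a * f s \<le> 1 - c * b * \<nu>" using fx fy by (simp add: algebra_simps)
  have fs: "1 - \<eta> \<le> f s"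
  proof -
    have "f s = f u + f (s - u)" by (simp add: linear_diff[OF f(1)])
    then show ?thesis using fN[of "s - u"] f(2) \<eta> by linarith
  qed
  have fs1: "f s \<le> 1" using fN[of s] arc[of 1 0] by simp
  have "(1 - \<tau>\<^sup>2) * f s \<le> 1 + \<tau>\<^sup>2 - c * (2 * \<tau>) * \<nu>"
  proof -
    have "(1 + \<tau>\<^sup>2) * (a * f s) \<le> (1 + \<tau>\<^sup>2) * (1 - c * b * \<nu>)" using main pos by (intro mult_left_mono) auto
    moreover have "(1 + \<tau>\<^sup>2) * (a * f s) = (1 - \<tau>\<^sup>2) * f s" using pos by (simp add: a_def)
    moreover have "(1 + \<tau>\<^sup>2) * (c * b * \<nu>) = c * (2 * \<tau>) * \<nu>" using pos by (simp add: b_def)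
    ultimately show ?thesis by (simp add: right_diff_distrib)
  qed
  moreover have "(1 - \<tau>\<^sup>2) * f s = f s - \<tau>\<^sup>2 * f s" by (simp add: algebra_simps)
  moreover have "\<tau>\<^sup>2 * f s \<le> \<tau>\<^sup>2 * 1" using fs1 by (intro mult_left_mono) auto
  ultimately have "2 * \<tau> * (c * \<nu>) \<le> 2 * \<tau>\<^sup>2 + \<eta>" using fs by (simp add: algebra_simps)
  then show ?thesis by (simp add: \<tau>_def power2_eq_square field_simps)
qed

lemma sharp_isometry:
  assumes T: "linear T" "surj T" "\<And>x. N (T x) = N x" and u: "sharp N c u"
  shows "sharp N c (T u)"
proof -
  obtain f where f: "linear f" "f u = 1" "\<And>x. N x \<le> 1 \<Longrightarrow> f x \<le> 1 - c * N (x - u)" and N: "N u = 1"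
    using u unfolding sharp_def by blast
  have "inj T"
    using T(3) N_zero_iff by (subst linear_inj_iff_eq_0[OF T(1)]) metis
  have inv: "inv_into UNIV T (T x) = x" for x using \<open>inj T\<close> by simp
  have T_inv: "T (inv_into UNIV T x) = x" for x using T(2) by (simp add: surj_f_inv_f)
  have lin: "linear (inv_into UNIV T)"
  proof (rule linearI)
    fix x y :: 'a and a :: real
    show "inv_into UNIV T (x + y) = inv_into UNIV T x + inv_into UNIV T y"
      using inv[of "inv_into UNIV T x + inv_into UNIV T y"] by (simp add: linear_add[OF T(1)] T_inv)
    show "inv_into UNIV T (a *\<^sub>R x) = a *\<^sub>R inv_into UNIV T x"
      using inv[of "a *\<^sub>R inv_into UNIV T x"] by (simp add: linear_scale[OF T(1)] T_inv)
  qed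
  have "(f \<circ> inv_into UNIV T) x \<le> 1 - c * N (x - T u)" if x: "N x \<le> 1" for x
  proof -
    let ?y = "inv_into UNIV T x"
    have "N ?y \<le> 1" using x T(3)[of ?y] T_inv[of x] by simp
    then have "f ?y \<le> 1 - c * N (?y - u)" by (rule f(3))
    moreover have "N (?y - u) = N (x - T u)" using T(3)[of "?y - u"] T_inv[of x] by (simp add: linear_diff[OF T(1)])
    ultimately show ?thesis by simp
  qed
  moreover have "linear (f \<circ> inv_into UNIV T)" using linear_compose[OF lin f(1)] .
  ultimately show ?thesis unfolding sharp_def using f(2) inv N T(3) by (auto intro!: exI[of _ "f \<circ> inv_into UNIV T"])
qed

text \<open>Approximation by elements of a uniformly separated set uses one and the same element at all small scales.\<close>

lemma separated_limit:
  assumes "0 < \<epsilon>" and near: "\<And>e. 0 < e \<Longrightarrow> e \<le> \<epsilon> \<Longrightarrow> \<exists>s\<in>D. N (s - u) \<le> e"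
    and sep: "\<And>s t. s \<in> D \<Longrightarrow> t \<in> D \<Longrightarrow> s \<noteq> t \<Longrightarrow> d \<le> N (s - t)" and "2 * \<epsilon> < d"
  shows "u \<in> D"
proof -
  obtain s where s: "s \<in> D" "N (s - u) \<le> \<epsilon>" using near[of \<epsilon>] \<open>0 < \<epsilon>\<close> by blast
  have "N (s - u) \<le> 0 + e" if e: "0 < e" for e
  proof -
    obtain t where t: "t \<in> D" "N (t - u) \<le> min e \<epsilon>" using near[of "min e \<epsilon>"] e assms(1) by (metis min.cobounded2 min_less_iff_conj)
    have "N (s - t) \<le> 2 * \<epsilon>" using N_triangle_diff[of s t u] N_minus_commute[of u t] s t by linarith
    then have "s = t" using sep[OF s(1) t(1)] assms by fastforce
    then show ?thesis using t by simp
  qed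
  then have "N (s - u) \<le> 0" by (rule field_le_epsilon)
  then show ?thesis using N_nonneg[of "s - u"] N_zero_iff[of "s - u"] s by simp
qed

end

section \<open>A norm whose isometries form a given group up to sign\<close>

text \<open>The data of the construction: a bounded action \<open>T\<close> of \<open>G\<close>, a system \<open>e\<close> with biorthogonal
functionals \<open>\<phi>\<close> on which \<open>G\<close> acts freely by left translation of the first index, invariant vectors
\<open>p\<close>, \<open>q\<close> spanning the plane in which atoms are rotated, and small invariant vectors \<open>w n\<close> that complete
the span of \<open>e\<close> to a dense subspace. The values of \<open>colour\<close> label the pairs \<open>(g, n)\<close>. Their range between
\<open>4/5\<close> and \<open>9/10\<close> leaves room to tell the norms of sums of linked spikes, at most \<open>5/4\<close>, from the norms
of all other nonzero sums of two spikes, at least \<open>4/3\<close>.\<close>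

locale group_spikes = group G for G (structure) +
  fixes T :: "'g \<Rightarrow> 'a::real_normed_vector \<Rightarrow> 'a"
    and e :: "'g \<times> nat \<Rightarrow> 'a" and \<phi> :: "'g \<times> nat \<Rightarrow> 'a \<Rightarrow> real"
    and p q :: 'a and w :: "nat \<Rightarrow> 'a" and colour :: "'g \<times> nat \<Rightarrow> real"
    and M \<kappa> \<mu> :: real
  assumes T_linear: "g \<in> carrier G \<Longrightarrow> linear (T g)"
    and T_mult: "g \<in> carrier G \<Longrightarrow> h \<in> carrier G \<Longrightarrow> T g (T h x) = T (g \<otimes> h) x"
    and T_one: "T \<one> x = x"
    and M: "0 < M" "g \<in> carrier G \<Longrightarrow> norm (T g x) \<le> M * norm x"
    and \<kappa>: "1 \<le> \<kappa>" "i \<in> carrier G \<times> UNIV \<Longrightarrow> norm (e i) \<le> \<kappa>"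
      "i \<in> carrier G \<times> UNIV \<Longrightarrow> \<bar>\<phi> i x\<bar> \<le> \<kappa> * norm x"
    and \<phi>_linear: "i \<in> carrier G \<times> UNIV \<Longrightarrow> linear (\<phi> i)"
    and \<phi>_e: "i \<in> carrier G \<times> UNIV \<Longrightarrow> j \<in> carrier G \<times> UNIV \<Longrightarrow> \<phi> i (e j) = (if i = j then 1 else 0)"
    and T_e: "g \<in> carrier G \<Longrightarrow> h \<in> carrier G \<Longrightarrow> T g (e (h, n)) = e (g \<otimes> h, n)"
    and \<phi>_pq: "i \<in> carrier G \<times> UNIV \<Longrightarrow> \<phi> i p = 0 \<and> \<phi> i q = 0"
    and T_pq: "g \<in> carrier G \<Longrightarrow> T g p = p \<and> T g q = q"
    and \<mu>: "0 < \<mu>" "s\<^sup>2 + t\<^sup>2 = 1 \<Longrightarrow> \<mu> \<le> norm (s *\<^sub>R p + t *\<^sub>R q)"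
    and \<phi>_w: "i \<in> carrier G \<times> UNIV \<Longrightarrow> \<phi> i (w n) = 0"
    and T_w: "g \<in> carrier G \<Longrightarrow> T g (w n) = w n"
    and w_small: "norm (w n) \<le> 1 / (40 * \<kappa>)"
    and dense: "closure (span (e ` (carrier G \<times> UNIV) \<union> range w)) = UNIV"
    and colour: "i \<in> carrier G \<times> UNIV \<Longrightarrow> 4/5 \<le> colour i \<and> colour i \<le> 9/10"
    and colour_inj: "inj_on colour (carrier G \<times> UNIV)"
begin

definition J where "J = carrier G \<times> (UNIV :: nat set)"

definition spikes where "spikes = {\<sigma> *\<^sub>R e i |\<sigma> i. \<bar>\<sigma>\<bar> = 1 \<and> i \<in> J}"

text \<open>A \<open>G\<close>-invariant neighbourhood of 0, small enough for every \<open>\<phi> i\<close> to be at most \<open>1/4\<close> on it.\<close>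

definition nbhd where "nbhd = {x. \<forall>g\<in>carrier G. norm (T g x) \<le> 1 / (4 * \<kappa>)}"

definition link where "link h g n = colour (g, n) *\<^sub>R (e (h, 0) + e (h \<otimes> g, Suc n))"

text \<open>The minus sign keeps the bonds away from the links: adding two linked spikes is not influenced by the bond
between them.\<close>

definition bond where "bond h n = (3/4) *\<^sub>R (e (h, 0) - e (h, Suc n)) + w n"

definition bonds where "bonds = {\<sigma> *\<^sub>R bond h n |\<sigma> h n. \<bar>\<sigma>\<bar> = 1 \<and> h \<in> carrier G}"

definition R where "R = 2 * \<kappa> + 2 + norm p + norm q"

text \<open>Lower bound for the gauge norm of the unit vectors \<open>b *\<^sub>R p + c *\<^sub>R q\<close> with \<open>b\<^sup>2 + c\<^sup>2 = 1\<close>, as \<open>R\<close> bounds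
the atoms in the original norm.\<close>

definition \<nu> where "\<nu> = \<mu> / R"

text \<open>How far a bond protrudes from the smooth part. By \<open>sharp_far_from_arcs\<close>, a point at distance less than
\<open>\<nu>\<^sup>2 / 800\<close> from the smooth part is not sharp with constant \<open>1/20\<close>. Half of that leaves room for approximation.\<close>

definition \<eta> where "\<eta> = min (1/3) (\<nu>\<^sup>2 / 1600)"

definition core where
  "core = nbhd \<union> {link h g n |h g n. h \<in> carrier G \<and> g \<in> carrier G} \<union> (\<lambda>x. (1 - \<eta>) *\<^sub>R x) ` bonds"

text \<open>Two rotation directions are used because any point \<open>a *\<^sub>R k + b *\<^sub>R p + c *\<^sub>R q\<close>, even with \<open>a = 0\<close>,
then admits a unit vector of the plane orthogonal to \<open>(b, c)\<close>, which is a tangent direction.\<close>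

definition smooth where
  "smooth = {a *\<^sub>R k + b *\<^sub>R p + c *\<^sub>R q |a b c k. k \<in> core \<and> a\<^sup>2 + b\<^sup>2 + c\<^sup>2 \<le> 1}"

definition S where "S = spikes \<union> bonds \<union> smooth"

lemma eta: "0 < \<eta>" "\<eta> \<le> 1/3" "\<eta> \<le> \<nu>\<^sup>2 / 1600" and nu: "0 < \<nu>" and R: "0 < R"
proof -
  show "0 < R" using \<kappa>(1) by (simp add: R_def add_pos_nonneg)
  then show "0 < \<nu>" using \<mu>(1) by (simp add: \<nu>_def)
  then show "0 < \<eta>" by (simp add: \<eta>_def)
  show "\<eta> \<le> 1/3" "\<eta> \<le> \<nu>\<^sup>2 / 1600" by (auto simp: \<eta>_def)
qed

lemma J_iff: "(g, n) \<in> J \<longleftrightarrow> g \<in> carrier G" by (simp add: J_def)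

lemma core_sub_smooth: "core \<subseteq> smooth"
proof
  fix k assume "k \<in> core"
  then show "k \<in> smooth"
    unfolding smooth_def by (intro CollectI exI[of _ 1] exI[of _ 0] exI[of _ k]) auto
qed

lemma ball_in_U: "norm x \<le> 1 / (4 * \<kappa> * M) \<Longrightarrow> x \<in> nbhd"
proof -
  assume x: "norm x \<le> 1 / (4 * \<kappa> * M)"
  have "norm (T g x) \<le> 1 / (4 * \<kappa>)" if "g \<in> carrier G" for g
  proof -
    have "norm (T g x) \<le> M * norm x" using M that by simp
    also have "\<dots> \<le> M * (1 / (4 * \<kappa> * M))" using x M by (intro mult_left_mono) auto
    finally show ?thesis using M by simp
  qed
  then show ?thesis by (simp add: nbhd_def)
qed

lemma U_norm: "x \<in> nbhd \<Longrightarrow> norm x \<le> 1 / (4 * \<kappa>)"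
  using T_one[of x] unfolding nbhd_def by force

lemma e_norm: "i \<in> J \<Longrightarrow> norm (e i) \<le> \<kappa>"
  using \<kappa>(2) by (simp add: J_def)

lemma w_norm_le_1: "norm (w n) \<le> 1"
proof -
  have "1 / (40 * \<kappa>) \<le> 1" using \<kappa>(1) by simp
  then show ?thesis using w_small[of n] by linarith
qed

lemma bond_norm: "h \<in> carrier G \<Longrightarrow> norm (bond h n) \<le> 2 * \<kappa> + 2"
proof -
  assume h: "h \<in> carrier G"
  have "norm (bond h n) \<le> norm ((3/4) *\<^sub>R (e (h, 0) - e (h, Suc n))) + norm (w n)"
    unfolding bond_def by (rule norm_triangle_ineq)
  moreover have "norm (e (h, 0) - e (h, Suc n)) \<le> \<kappa> + \<kappa>"
    using norm_triangle_ineq4[of "e (h, 0)" "e (h, Suc n)"] e_norm[of "(h,0)"] e_norm[of "(h, Suc n)"] h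
    by (simp add: J_iff)
  ultimately show ?thesis using w_norm_le_1[of n] \<kappa>(1) by simp
qed

lemma link_norm:
  assumes h: "h \<in> carrier G" "g \<in> carrier G"
  shows "norm (link h g n) \<le> 2 * \<kappa> + 2"
proof -
  have "norm (e (h, 0) + e (h \<otimes> g, Suc n)) \<le> 2 * \<kappa>"
    using norm_triangle_ineq[of "e (h, 0)" "e (h \<otimes> g, Suc n)"] e_norm[of "(h,0)"] e_norm[of "(h \<otimes> g, Suc n)"] h
    by (simp add: J_iff)
  then have "colour (g, n) * norm (e (h, 0) + e (h \<otimes> g, Suc n)) \<le> 1 * (2 * \<kappa>)"
    using colour[of "(g, n)"] h by (intro mult_mono) auto
  then show ?thesis using colour[of "(g, n)"] h by (simp add: link_def)
qed

lemma core_norm: "k \<in> core \<Longrightarrow> norm k \<le> 2 * \<kappa> + 2"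
proof -
  assume "k \<in> core"
  then consider "k \<in> nbhd" | h g n where "k = link h g n" "h \<in> carrier G" "g \<in> carrier G"
    | \<sigma> h n where "k = (1 - \<eta>) *\<^sub>R (\<sigma> *\<^sub>R bond h n)" "\<bar>\<sigma>\<bar> = 1" "h \<in> carrier G"
    unfolding core_def bonds_def by blast
  then show ?thesis
  proof cases
    case 1
    have "1 / (4 * \<kappa>) \<le> 1" using \<kappa>(1) by simp
    then show ?thesis using U_norm[OF 1] \<kappa>(1) by linarith
  next
    case 2 then show ?thesis using link_norm by simp
  next
    case 3
    then have "norm k = (1 - \<eta>) * norm (bond h n)" using eta by (simp add: abs_mult)
    also have "\<dots> \<le> 1 * norm (bond h n)" using eta by (intro mult_right_mono) auto
    finally show ?thesis using bond_norm[OF 3(3), of n] by simp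
  qed
qed

lemma coeff_le_1:
  fixes a b c :: real
  assumes "a\<^sup>2 + b\<^sup>2 + c\<^sup>2 \<le> 1"
  shows "\<bar>a\<bar> \<le> 1" "\<bar>b\<bar> \<le> 1" "\<bar>c\<bar> \<le> 1"
proof -
  have "a\<^sup>2 \<le> 1" "b\<^sup>2 \<le> 1" "c\<^sup>2 \<le> 1"
    using assms zero_le_power2[of a] zero_le_power2[of b] zero_le_power2[of c] by linarith+
  then show "\<bar>a\<bar> \<le> 1" "\<bar>b\<bar> \<le> 1" "\<bar>c\<bar> \<le> 1" by (simp_all add: abs_square_le_1)
qed

lemma S_norm: "s \<in> S \<Longrightarrow> norm s \<le> R"
proof -
  assume "s \<in> S"
  then consider "s \<in> spikes" | "s \<in> bonds" | "s \<in> smooth" unfolding S_def by blast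
  then show ?thesis
  proof cases
    case 1
    then obtain \<sigma> i where s: "s = \<sigma> *\<^sub>R e i" "\<bar>\<sigma>\<bar> = 1" "i \<in> J" unfolding spikes_def by blast
    have "norm s \<le> 2 * \<kappa> + 2" using e_norm[OF s(3)] s \<kappa>(1) by simp
    then show ?thesis unfolding R_def using norm_ge_zero[of p] norm_ge_zero[of q] by linarith
  next
    case 2
    then obtain \<sigma> h n where s: "s = \<sigma> *\<^sub>R bond h n" "\<bar>\<sigma>\<bar> = 1" "h \<in> carrier G" unfolding bonds_def by blast
    have "norm s \<le> 2 * \<kappa> + 2" using bond_norm[OF s(3), of n] s by simp
    then show ?thesis unfolding R_def using norm_ge_zero[of p] norm_ge_zero[of q] by linarith
  next
    case 3
    then obtain a b c k where s: "s = a *\<^sub>R k + b *\<^sub>R p + c *\<^sub>R q" "k \<in> core" "a\<^sup>2 + b\<^sup>2 + c\<^sup>2 \<le> 1"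
      unfolding smooth_def by blast
    have "norm s \<le> norm (a *\<^sub>R k) + norm (b *\<^sub>R p) + norm (c *\<^sub>R q)"
      unfolding s(1) by (intro order_trans[OF norm_triangle_ineq] add_mono norm_triangle_ineq) auto
    also have "\<dots> \<le> 1 * norm k + 1 * norm p + 1 * norm q"
      using coeff_le_1[OF s(3)] by (simp only: norm_scaleR) (intro add_mono mult_right_mono, auto)
    finally show ?thesis using core_norm[OF s(2)] by (simp add: R_def)
  qed
qed

lemma S_uminus: "s \<in> S \<Longrightarrow> - s \<in> S"
proof -
  have 1: "- s \<in> spikes" if s: "s \<in> spikes" for s
  proof -
    obtain \<sigma> i where "s = \<sigma> *\<^sub>R e i" "\<bar>\<sigma>\<bar> = 1" "i \<in> J" using s unfolding spikes_def by blast
    then show ?thesis unfolding spikes_def by (intro CollectI exI[of _ "- \<sigma>"] exI[of _ i]) auto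
  qed
  have 2: "- s \<in> bonds" if s: "s \<in> bonds" for s
  proof -
    obtain \<sigma> h n where "s = \<sigma> *\<^sub>R bond h n" "\<bar>\<sigma>\<bar> = 1" "h \<in> carrier G" using s unfolding bonds_def by blast
    then show ?thesis unfolding bonds_def by (intro CollectI exI[of _ "- \<sigma>"] exI[of _ h] exI[of _ n]) auto
  qed
  have 3: "- s \<in> smooth" if s: "s \<in> smooth" for s
  proof -
    obtain a b c k where "s = a *\<^sub>R k + b *\<^sub>R p + c *\<^sub>R q" "k \<in> core" "a\<^sup>2 + b\<^sup>2 + c\<^sup>2 \<le> 1"
      using s unfolding smooth_def by blast
    then show ?thesis unfolding smooth_def
      by (intro CollectI exI[of _ "- a"] exI[of _ "- b"] exI[of _ "- c"] exI[of _ k]) auto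
  qed
  show "s \<in> S \<Longrightarrow> - s \<in> S" unfolding S_def using 1 2 3 by blast
qed

sublocale atoms S "1 / (4 * \<kappa> * M)" R
proof
  show "0 < 1 / (4 * \<kappa> * M)" using \<kappa>(1) M(1) by simp
  show "x \<in> S" if "norm x \<le> 1 / (4 * \<kappa> * M)" for x
    using ball_in_U[OF that] core_sub_smooth unfolding S_def core_def by blast
qed (use S_uminus S_norm in auto)

lemma T_core: "g \<in> carrier G \<Longrightarrow> k \<in> core \<Longrightarrow> T g k \<in> core"
  and T_bonds: "g \<in> carrier G \<Longrightarrow> k \<in> bonds \<Longrightarrow> T g k \<in> bonds"
  and T_spikes: "g \<in> carrier G \<Longrightarrow> k \<in> spikes \<Longrightarrow> T g k \<in> spikes"
proof -
  have bond: "T g (bond h n) = bond (g \<otimes> h) n" if "g \<in> carrier G" "h \<in> carrier G" for g h n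
    unfolding bond_def
    using that by (simp add: linear_add[OF T_linear] linear_scale[OF T_linear] linear_diff[OF T_linear] T_e T_w)
  show bonds: "T g k \<in> bonds" if g: "g \<in> carrier G" "k \<in> bonds" for g k
  proof -
    obtain \<sigma> h n where k: "k = \<sigma> *\<^sub>R bond h n" "\<bar>\<sigma>\<bar> = 1" "h \<in> carrier G" using g(2) unfolding bonds_def by blast
    then have "T g k = \<sigma> *\<^sub>R bond (g \<otimes> h) n" using g(1) bond by (simp add: linear_scale[OF T_linear])
    then show ?thesis using k g(1) unfolding bonds_def by blast
  qed
  show "T g k \<in> spikes" if g: "g \<in> carrier G" "k \<in> spikes" for g k
  proof -
    obtain \<sigma> h n where k: "k = \<sigma> *\<^sub>R e (h, n)" "\<bar>\<sigma>\<bar> = 1" "h \<in> carrier G" using g(2) unfolding spikes_def J_def by blast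
    then have "T g k = \<sigma> *\<^sub>R e (g \<otimes> h, n)" using g(1) T_e by (simp add: linear_scale[OF T_linear])
    then show ?thesis using k g(1) unfolding spikes_def J_def by blast
  qed
  show "T g k \<in> core" if g: "g \<in> carrier G" "k \<in> core" for g k
  proof -
    consider "k \<in> nbhd" | h l n where "k = link h l n" "h \<in> carrier G" "l \<in> carrier G"
      | r where "k = (1 - \<eta>) *\<^sub>R r" "r \<in> bonds"
      using g(2) unfolding core_def by blast
    then show ?thesis
    proof cases
      case 1
      then have "T g k \<in> nbhd" using g(1) T_mult unfolding nbhd_def by simp
      then show ?thesis by (simp add: core_def)
    next
      case 2
      then have "T g k = link (g \<otimes> h) l n"
        using g(1) by (simp add: link_def linear_add[OF T_linear] linear_scale[OF T_linear] T_e m_assoc)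
      then show ?thesis using 2 g(1) unfolding core_def by blast
    next
      case 3
      then have "T g k = (1 - \<eta>) *\<^sub>R T g r" using g(1) by (simp add: linear_scale[OF T_linear])
      then show ?thesis using bonds[OF g(1) 3(2)] unfolding core_def by blast
    qed
  qed
qed

lemma T_image_S: "g \<in> carrier G \<Longrightarrow> T g ` S \<subseteq> S"
proof -
  assume g: "g \<in> carrier G"
  have "T g s \<in> smooth" if s: "s \<in> smooth" for s
  proof -
    obtain a b c k where "s = a *\<^sub>R k + b *\<^sub>R p + c *\<^sub>R q" "k \<in> core" "a\<^sup>2 + b\<^sup>2 + c\<^sup>2 \<le> 1"
      using s unfolding smooth_def by blast
    moreover from this have "T g s = a *\<^sub>R T g k + b *\<^sub>R p + c *\<^sub>R q"
      using g T_pq by (simp add: linear_add[OF T_linear] linear_scale[OF T_linear])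
    ultimately show ?thesis using T_core[OF g] unfolding smooth_def by blast
  qed
  then show ?thesis using T_bonds[OF g] T_spikes[OF g] unfolding S_def by blast
qed

lemma T_isometry: "g \<in> carrier G \<Longrightarrow> N (T g x) = N x"
proof -
  assume g: "g \<in> carrier G"
  have "N (T (inv g) (T g x)) \<le> N (T g x)" using g by (intro N_linear_image_le T_linear T_image_S) auto
  moreover have "T (inv g) (T g x) = x" using g by (simp add: T_mult T_one)
  ultimately show ?thesis using N_linear_image_le[OF T_linear[OF g] T_image_S[OF g], of x] by simp
qed

text \<open>Since \<open>p\<close> and \<open>q\<close> are in the kernel of \<open>f\<close>, a bound on the core passes to all its rotated copies.
Functionals using at most two of the coordinates \<open>\<phi> i\<close> suffice for all norm computations below.\<close>

lemma functional_bound: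
  fixes f :: "'a \<Rightarrow> real"
  assumes f: "f = (\<lambda>x. \<alpha> * \<phi> i x + \<beta> * \<phi> j x)" and ij: "i \<in> J" "j \<in> J"
    and small: "\<bar>\<alpha>\<bar> + \<bar>\<beta>\<bar> \<le> 4 * b"
    and links: "\<And>h g n. h \<in> carrier G \<Longrightarrow> g \<in> carrier G \<Longrightarrow> colour (g, n) * \<bar>f (e (h, 0)) + f (e (h \<otimes> g, Suc n))\<bar> \<le> b"
    and bnds: "\<And>h n. h \<in> carrier G \<Longrightarrow> (1 - \<eta>) * \<bar>f (bond h n)\<bar> \<le> b"
  shows "linear f" and "s \<in> smooth \<Longrightarrow> f s \<le> b"
proof -
  have ij': "i \<in> carrier G \<times> UNIV" "j \<in> carrier G \<times> UNIV" using ij by (auto simp: J_def)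
  note lin = \<phi>_linear[OF ij'(1)] \<phi>_linear[OF ij'(2)]
  show lf: "linear f" unfolding f
    by (rule linearI) (simp_all add: linear_add[OF lin(1)] linear_add[OF lin(2)] linear_scale[OF lin(1)] linear_scale[OF lin(2)] algebra_simps)
  have b: "0 \<le> b" using small by linarith
  have fpq: "f p = 0" "f q = 0" using \<phi>_pq ij' by (auto simp: f)
  have core: "\<bar>f k\<bar> \<le> b" if k: "k \<in> core" for k
  proof -
    consider "k \<in> nbhd" | h g n where "k = link h g n" "h \<in> carrier G" "g \<in> carrier G"
      | \<sigma> h n where "k = (1 - \<eta>) *\<^sub>R (\<sigma> *\<^sub>R bond h n)" "\<bar>\<sigma>\<bar> = 1" "h \<in> carrier G"
      using k unfolding core_def bonds_def by blast
    then show ?thesis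
    proof cases
      case 1
      have *: "\<bar>\<phi> l k\<bar> \<le> 1/4" if "l \<in> carrier G \<times> UNIV" for l
      proof -
        have "\<kappa> * norm k \<le> \<kappa> * (1 / (4 * \<kappa>))" using U_norm[OF 1] \<kappa>(1) by (intro mult_left_mono) auto
        then show ?thesis using \<kappa>(3)[OF that, of k] \<kappa>(1) by simp
      qed
      have "\<bar>f k\<bar> \<le> \<bar>\<alpha>\<bar> * \<bar>\<phi> i k\<bar> + \<bar>\<beta>\<bar> * \<bar>\<phi> j k\<bar>" unfolding f by (metis abs_mult abs_triangle_ineq)
      also have "\<dots> \<le> \<bar>\<alpha>\<bar> * (1/4) + \<bar>\<beta>\<bar> * (1/4)" by (intro add_mono mult_left_mono * ij') auto
      finally show ?thesis using small by linarith
    next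
      case 2
      have "f k = colour (g, n) * (f (e (h, 0)) + f (e (h \<otimes> g, Suc n)))"
        unfolding 2 link_def by (simp add: linear_add[OF lf] linear_scale[OF lf])
      moreover have "colour (g, n) \<ge> 0" using colour[of "(g, n)"] 2 by auto
      ultimately show ?thesis using links[OF 2(2,3), of n] by (simp add: abs_mult)
    next
      case 3
      have "f k = (1 - \<eta>) * (\<sigma> * f (bond h n))" unfolding 3 by (simp add: linear_scale[OF lf])
      then show ?thesis using bnds[OF 3(3), of n] 3(2) eta by (simp add: abs_mult)
    qed
  qed
  show "f s \<le> b" if s: "s \<in> smooth"
  proof -
    obtain a b' c k where s: "s = a *\<^sub>R k + b' *\<^sub>R p + c *\<^sub>R q" "k \<in> core" "a\<^sup>2 + b'\<^sup>2 + c\<^sup>2 \<le> 1"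
      using s unfolding smooth_def by blast
    have "f s = a * f k" unfolding s(1) by (simp add: linear_add[OF lf] linear_scale[OF lf] fpq)
    also have "\<dots> \<le> \<bar>a\<bar> * \<bar>f k\<bar>" by (metis abs_ge_self abs_mult)
    also have "\<dots> \<le> 1 * b" using coeff_le_1[OF s(3)] core[OF s(2)] b by (intro mult_mono) auto
    finally show ?thesis by simp
  qed
qed

lemma functional_N_bound:
  fixes f :: "'a \<Rightarrow> real"
  assumes f: "f = (\<lambda>x. \<alpha> * \<phi> i x + \<beta> * \<phi> j x)" and ij: "i \<in> J" "j \<in> J"
    and small: "\<bar>\<alpha>\<bar> + \<bar>\<beta>\<bar> \<le> 4 * b"
    and sp: "\<And>l. l \<in> J \<Longrightarrow> \<bar>f (e l)\<bar> \<le> b"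
    and links: "\<And>h g n. h \<in> carrier G \<Longrightarrow> g \<in> carrier G \<Longrightarrow> colour (g, n) * \<bar>f (e (h, 0)) + f (e (h \<otimes> g, Suc n))\<bar> \<le> b"
    and bnds: "\<And>h n. h \<in> carrier G \<Longrightarrow> \<bar>f (bond h n)\<bar> \<le> b"
  shows "\<bar>f x\<bar> \<le> b * N x"
proof -
  have b: "0 \<le> b" using small by linarith
  have bnds': "(1 - \<eta>) * \<bar>f (bond h n)\<bar> \<le> b" if "h \<in> carrier G" for h n
  proof -
    have "(1 - \<eta>) * \<bar>f (bond h n)\<bar> \<le> 1 * \<bar>f (bond h n)\<bar>" using eta by (intro mult_right_mono) auto
    then show ?thesis using bnds[OF that, of n] by linarith
  qed
  note fb = functional_bound[OF f ij small links bnds']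
  have lf: "linear f" by (rule fb)
  have "f s \<le> b" if "s \<in> S" for s
  proof -
    consider \<sigma> i where "s = \<sigma> *\<^sub>R e i" "\<bar>\<sigma>\<bar> = 1" "i \<in> J"
      | \<sigma> h n where "s = \<sigma> *\<^sub>R bond h n" "\<bar>\<sigma>\<bar> = 1" "h \<in> carrier G" | "s \<in> smooth"
      using \<open>s \<in> S\<close> unfolding S_def spikes_def bonds_def by blast
    then show ?thesis
    proof cases
      case 1
      have "f s \<le> \<bar>\<sigma> * f (e i)\<bar>" unfolding 1 by (simp add: linear_scale[OF lf])
      then show ?thesis using sp[OF 1(3)] 1(2) by (simp add: abs_mult)
    next
      case 2
      have "f s \<le> \<bar>\<sigma> * f (bond h n)\<bar>" unfolding 2 by (simp add: linear_scale[OF lf])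
      then show ?thesis using bnds[OF 2(3), of n] 2(2) by (simp add: abs_mult)
    next
      case 3 then show ?thesis by (intro fb(2)) auto
    qed
  qed
  then show ?thesis using functional_le_N[OF lf b] by blast
qed

lemma \<phi>_e_J: "i \<in> J \<Longrightarrow> j \<in> J \<Longrightarrow> \<phi> i (e j) = (if i = j then 1 else 0)"
  using \<phi>_e by (simp add: J_def)

lemma linear_phi: "i \<in> J \<Longrightarrow> linear (\<phi> i)"
  using \<phi>_linear by (simp add: J_def)

lemma \<phi>_bond: "i \<in> J \<Longrightarrow> h \<in> carrier G \<Longrightarrow>
    \<phi> i (bond h n) = 3/4 * ((if i = (h, 0) then 1 else 0) - (if i = (h, Suc n) then 1 else 0))"
  unfolding bond_def
  by (simp add: linear_add[OF linear_phi] linear_diff[OF linear_phi] linear_scale[OF linear_phi] \<phi>_e_J J_iff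
      \<phi>_w[unfolded J_def[symmetric]])

lemma abs_eq_1_cases: "\<bar>\<sigma>::real\<bar> = 1 \<Longrightarrow> \<sigma> = 1 \<or> \<sigma> = -1" by linarith

lemma colour_bounds: "g \<in> carrier G \<Longrightarrow> 4/5 \<le> colour (g, n) \<and> colour (g, n) \<le> 9/10"
  using colour by simp

text \<open>The coordinate \<open>\<phi> i\<close> is 1 at the spike, at most \<open>9/10\<close> at links, and at most \<open>3/4\<close> at bonds.\<close>

lemma spike_sharp:
  assumes i: "i \<in> J" and \<sigma>: "\<bar>\<sigma>\<bar> = 1"
  shows "sharp N (1/20) (\<sigma> *\<^sub>R e i)"
proof -
  define f where "f = (\<lambda>x. \<sigma> * \<phi> i x + 0 * \<phi> i x)"
  have fe: "f (e l) = (if i = l then \<sigma> else 0)" if "l \<in> J" for l using that i by (simp add: f_def \<phi>_e_J)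
  have fbond: "\<bar>f (bond h n)\<bar> \<le> 3/4" if "h \<in> carrier G" for h n
    using that i \<sigma> by (simp add: f_def \<phi>_bond abs_mult)
  have links: "colour (g, n) * \<bar>f (e (h, 0)) + f (e (h \<otimes> g, Suc n))\<bar> \<le> 9/10"
    if "h \<in> carrier G" "g \<in> carrier G" for h g n
  proof -
    have "\<bar>f (e (h, 0)) + f (e (h \<otimes> g, Suc n))\<bar> \<le> 1" using that \<sigma> by (simp add: fe J_iff)
    then have "colour (g, n) * \<bar>f (e (h, 0)) + f (e (h \<otimes> g, Suc n))\<bar> \<le> 9/10 * 1"
      using colour_bounds[OF that(2), of n] by (intro mult_mono) auto
    then show ?thesis by simp
  qed
  have bnds: "(1 - \<eta>) * \<bar>f (bond h n)\<bar> \<le> 9/10" if "h \<in> carrier G" for h n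
  proof -
    have "(1 - \<eta>) * \<bar>f (bond h n)\<bar> \<le> 1 * (3/4)" using eta fbond[OF that] by (intro mult_mono) auto
    then show ?thesis by simp
  qed
  note fb = functional_bound[OF f_def i i _ links bnds]
  have lf: "linear f" by (rule fb) (use \<sigma> in auto)
  show ?thesis
  proof (rule isolated_atom_sharp[OF lf])
    show "\<sigma> *\<^sub>R e i \<in> S" using i \<sigma> unfolding S_def spikes_def by blast
    show "f (\<sigma> *\<^sub>R e i) = 1" using fe[OF i] abs_eq_1_cases[OF \<sigma>] by (auto simp: linear_scale[OF lf])
    fix s assume s: "s \<in> S" "s \<noteq> \<sigma> *\<^sub>R e i"
    consider \<tau> l where "s = \<tau> *\<^sub>R e l" "\<bar>\<tau>\<bar> = 1" "l \<in> J"
      | \<tau> h n where "s = \<tau> *\<^sub>R bond h n" "\<bar>\<tau>\<bar> = 1" "h \<in> carrier G" | "s \<in> smooth"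
      using s(1) unfolding S_def spikes_def bonds_def by blast
    then have "f s \<le> 9/10"
    proof cases
      case 1
      then show ?thesis using s(2) abs_eq_1_cases[OF \<sigma>] abs_eq_1_cases[OF 1(2)] by (auto simp: linear_scale[OF lf] fe)
    next
      case 2
      have "f s \<le> \<bar>\<tau> * f (bond h n)\<bar>" unfolding 2 by (simp add: linear_scale[OF lf])
      then show ?thesis using fbond[OF 2(3), of n] 2(2) by (simp add: abs_mult)
    next
      case 3 then show ?thesis by (intro fb) (use \<sigma> in auto)
    qed
    then show "f s \<le> 1 - 2 * (1/20)" by simp
  qed auto
qed

lemma \<phi>_le_N: "i \<in> J \<Longrightarrow> \<bar>\<phi> i x\<bar> \<le> N x"
proof -
  assume i: "i \<in> J"
  define f where "f = (\<lambda>x. 1 * \<phi> i x + 0 * \<phi> i x)"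
  have "\<bar>f x\<bar> \<le> 1 * N x"
  proof (rule functional_N_bound[OF f_def i i])
    fix h g n assume h: "h \<in> carrier G" "g \<in> carrier G"
    have "\<bar>f (e (h, 0)) + f (e (h \<otimes> g, Suc n))\<bar> \<le> 1" using h i by (simp add: f_def \<phi>_e_J J_iff)
    then have "colour (g, n) * \<bar>f (e (h, 0)) + f (e (h \<otimes> g, Suc n))\<bar> \<le> 1 * 1"
      using colour_bounds[OF h(2), of n] by (intro mult_mono) auto
    then show "colour (g, n) * \<bar>f (e (h, 0)) + f (e (h \<otimes> g, Suc n))\<bar> \<le> 1" by simp
  qed (use i in \<open>auto simp: f_def \<phi>_e_J \<phi>_bond\<close>)
  then show ?thesis by (simp add: f_def)
qed

lemma spikes_separated:
  assumes "s \<in> spikes" "t \<in> spikes" "s \<noteq> t"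
  shows "1 \<le> N (s - t)"
proof -
  obtain \<sigma> i where s: "s = \<sigma> *\<^sub>R e i" "\<bar>\<sigma>\<bar> = 1" "i \<in> J" using assms unfolding spikes_def by blast
  obtain \<tau> j where t: "t = \<tau> *\<^sub>R e j" "\<bar>\<tau>\<bar> = 1" "j \<in> J" using assms unfolding spikes_def by blast
  have "\<phi> i (s - t) = \<sigma> - \<tau> * (if i = j then 1 else 0)"
    using s t by (simp add: linear_diff[OF linear_phi] linear_scale[OF linear_phi] \<phi>_e_J)
  then have "1 \<le> \<bar>\<phi> i (s - t)\<bar>" using assms(3) s t abs_eq_1_cases[OF s(2)] abs_eq_1_cases[OF t(2)] by auto
  then show ?thesis using \<phi>_le_N[OF s(3), of "s - t"] by linarith
qed

text \<open>Rotating \<open>s\<close> towards a unit vector of the plane orthogonal to its own component in that plane stays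
inside the smooth part.\<close>

lemma smooth_arc:
  assumes "s \<in> smooth"
  obtains v where "\<nu> \<le> N v" "\<And>x y. x\<^sup>2 + y\<^sup>2 = 1 \<Longrightarrow> N (x *\<^sub>R s + y *\<^sub>R v) \<le> 1"
proof -
  obtain a b c k where s: "s = a *\<^sub>R k + b *\<^sub>R p + c *\<^sub>R q" "k \<in> core" "a\<^sup>2 + b\<^sup>2 + c\<^sup>2 \<le> 1"
    using assms unfolding smooth_def by blast
  obtain \<beta> \<gamma> :: real where bg: "\<beta>\<^sup>2 + \<gamma>\<^sup>2 = 1" "b * \<beta> + c * \<gamma> = 0"
  proof (cases "b\<^sup>2 + c\<^sup>2 = 0")
    case True
    then have "b = 0" "c = 0" by (auto simp: sum_power2_eq_zero_iff)
    then show ?thesis using that[of 1 0] by simp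
  next
    case False
    then have pos: "0 < b\<^sup>2 + c\<^sup>2" by (metis add_nonneg_nonneg order_less_le zero_le_power2)
    have "(- c / sqrt (b\<^sup>2 + c\<^sup>2))\<^sup>2 + (b / sqrt (b\<^sup>2 + c\<^sup>2))\<^sup>2 = 1"
      using pos by (auto simp: power_divide add_divide_distrib[symmetric] add.commute)
    then show ?thesis using that[of "- c / sqrt (b\<^sup>2 + c\<^sup>2)" "b / sqrt (b\<^sup>2 + c\<^sup>2)"] by (simp add: mult.commute)
  qed
  define v where "v = \<beta> *\<^sub>R p + \<gamma> *\<^sub>R q"
  have "\<mu> \<le> R * N v" using \<mu>(2)[OF bg(1)] norm_le_N[of v] unfolding v_def by linarith
  then have "\<nu> \<le> N v" using R unfolding \<nu>_def by (simp add: field_simps)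
  moreover have "N (x *\<^sub>R s + y *\<^sub>R v) \<le> 1" if xy: "x\<^sup>2 + y\<^sup>2 = 1" for x y
  proof (rule N_atom)
    have "x *\<^sub>R s + y *\<^sub>R v = (x * a) *\<^sub>R k + (x * b + y * \<beta>) *\<^sub>R p + (x * c + y * \<gamma>) *\<^sub>R q"
      unfolding s v_def by (simp add: algebra_simps)
    moreover have "(x * a)\<^sup>2 + (x * b + y * \<beta>)\<^sup>2 + (x * c + y * \<gamma>)\<^sup>2 \<le> 1"
    proof -
      have "(x * a)\<^sup>2 + (x * b + y * \<beta>)\<^sup>2 + (x * c + y * \<gamma>)\<^sup>2
          = x\<^sup>2 * (a\<^sup>2 + b\<^sup>2 + c\<^sup>2) + y\<^sup>2 * (\<beta>\<^sup>2 + \<gamma>\<^sup>2) + 2 * x * y * (b * \<beta> + c * \<gamma>)"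
        by (simp add: power2_eq_square algebra_simps)
      also have "\<dots> \<le> x\<^sup>2 * 1 + y\<^sup>2"
        using mult_left_mono[OF s(3), of "x\<^sup>2"] bg by simp
      finally show ?thesis using xy by simp
    qed
    ultimately have "x *\<^sub>R s + y *\<^sub>R v \<in> smooth" using s(2) unfolding smooth_def by blast
    then show "x *\<^sub>R s + y *\<^sub>R v \<in> S" unfolding S_def by simp
  qed
  ultimately show ?thesis using that by blast
qed

lemma sharp_far_from_smooth:
  assumes "sharp N c u" "0 \<le> c" "s \<in> smooth"
  shows "c\<^sup>2 * \<nu>\<^sup>2 \<le> 2 * N (s - u)"
proof -
  obtain v where v: "\<nu> \<le> N v" "\<And>x y. x\<^sup>2 + y\<^sup>2 = 1 \<Longrightarrow> N (x *\<^sub>R s + y *\<^sub>R v) \<le> 1"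
    using smooth_arc[OF assms(3)] by blast
  show ?thesis by (rule sharp_far_from_arcs[OF assms(1,2) order_refl _ v]) (use nu in auto)
qed

text \<open>Close to a sharp point there are atoms. They do not belong to the smooth part, nor are they bonds, because a bond is
within \<open>\<eta>\<close> of the smooth part. So they are spikes, and spikes are separated.\<close>

lemma sharp_imp_spike:
  assumes u: "sharp N (1/20) u"
  shows "u \<in> spikes"
proof -
  define \<epsilon> where "\<epsilon> = min (1/4) (\<nu>\<^sup>2 / 3200)"
  have nu2: "0 < \<nu>\<^sup>2" using nu by simp
  have eps: "0 < \<epsilon>" "\<epsilon> \<le> 1/4" "\<epsilon> \<le> \<nu>\<^sup>2 / 3200" using nu by (auto simp: \<epsilon>_def)
  have far: "\<nu>\<^sup>2 / 800 \<le> N (s - u)" if "s \<in> smooth" for s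
    using sharp_far_from_smooth[OF u _ that] by (simp add: power2_eq_square)
  have "\<exists>s\<in>spikes. N (s - u) \<le> d" if d: "0 < d" "d \<le> \<epsilon>" for d
  proof -
    obtain s where s: "s \<in> S" "N (s - u) \<le> d" using sharp_near_atom[OF u _ d(1)] by auto
    have "s \<notin> smooth" using far[of s] s d eps nu2 by auto
    moreover have "s \<notin> bonds"
    proof
      assume b: "s \<in> bonds"
      then have "(1 - \<eta>) *\<^sub>R s \<in> smooth" using core_sub_smooth unfolding core_def by blast
      then have "\<nu>\<^sup>2 / 800 \<le> N ((1 - \<eta>) *\<^sub>R s - u)" by (rule far)
      also have "\<dots> \<le> N ((1 - \<eta>) *\<^sub>R s - s) + N (s - u)" by (rule N_triangle_diff)
      also have "(1 - \<eta>) *\<^sub>R s - s = (- \<eta>) *\<^sub>R s" by (simp add: algebra_simps)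
      also have "N ((- \<eta>) *\<^sub>R s) \<le> \<eta> * 1"
        using N_scale[of "- \<eta>" s] eta N_atom[OF s(1)] by simp
      finally show False using s d eps eta nu2 by linarith
    qed
    ultimately show ?thesis using s unfolding S_def by blast
  qed
  then show ?thesis
    by (rule separated_limit[OF eps(1) _ spikes_separated]) (use eps in auto)
qed

text \<open>The link itself gives the upper bound. The functional \<open>\<phi> i + \<phi> j\<close>, normalised to be 1 at the link,
gives the lower bound: any other link contains at most one of the two spikes, since together they determine \<open>h\<close>, \<open>g\<close> and \<open>n\<close>.\<close>

lemma N_link:
  assumes h: "h \<in> carrier G" "g \<in> carrier G"
  shows "N (e (h, 0) + e (h \<otimes> g, Suc n)) = 1 / colour (g, n)"
proof -
  let ?c = "colour (g, n)" and ?x = "e (h, 0) + e (h \<otimes> g, Suc n)"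
  have c: "4/5 \<le> ?c" "?c \<le> 9/10" using colour_bounds[OF h(2)] by auto
  have "link h g n \<in> S" using h core_sub_smooth unfolding S_def core_def by blast
  then have "N (?c *\<^sub>R ?x) \<le> 1" using N_atom unfolding link_def by blast
  then have "?c * N ?x \<le> 1" using c by (simp only: N_scale)
  then have "N ?x \<le> 1 / ?c" using c by (simp add: field_simps)
  moreover have "1 / ?c \<le> N ?x"
  proof -
    define a where "a = 1 / (2 * ?c)"
    have a: "0 < a" "a \<le> 5/8" "?c * (2 * a) = 1" using c by (auto simp: a_def field_simps)
    define f where "f = (\<lambda>x. a * \<phi> (h, 0) x + a * \<phi> (h \<otimes> g, Suc n) x)"
    have J: "(h, 0) \<in> J" "(h \<otimes> g, Suc n) \<in> J" using h by (auto simp: J_iff)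
    have "\<bar>f ?x\<bar> \<le> 1 * N ?x"
    proof (rule functional_N_bound[OF f_def J])
      fix h' g' n' assume h': "h' \<in> carrier G" "g' \<in> carrier G"
      have fe: "f (e (h', 0)) + f (e (h' \<otimes> g', Suc n'))
          = a * ((if h = h' then 1 else 0) + (if h \<otimes> g = h' \<otimes> g' \<and> n = n' then 1 else 0))"
        using h h' by (simp add: f_def \<phi>_e_J J_iff)
      show "colour (g', n') * \<bar>f (e (h', 0)) + f (e (h' \<otimes> g', Suc n'))\<bar> \<le> 1"
      proof (cases "h = h' \<and> h \<otimes> g = h' \<otimes> g' \<and> n = n'")
        case True
        then have "g = g'" using h h' by auto
        then show ?thesis using True a unfolding fe by simp
      next
        case False
        then have "\<bar>f (e (h', 0)) + f (e (h' \<otimes> g', Suc n'))\<bar> \<le> 5/8" using a unfolding fe by auto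
        then have "colour (g', n') * \<bar>f (e (h', 0)) + f (e (h' \<otimes> g', Suc n'))\<bar> \<le> 9/10 * (5/8)"
          using colour_bounds[OF h'(2), of n'] by (intro mult_mono) auto
        then show ?thesis by simp
      qed
    qed (use J h a in \<open>auto simp: f_def \<phi>_e_J \<phi>_bond abs_mult\<close>)
    moreover have "f ?x = 1 / ?c"
      using J by (simp add: f_def linear_add[OF linear_phi] \<phi>_e_J a_def)
    ultimately show ?thesis by linarith
  qed
  ultimately show ?thesis by simp
qed

lemma N_unlinked:
  assumes i: "(h, m) \<in> J" "(h', m') \<in> J" "(h, m) \<noteq> (h', m')" and m: "m = 0 \<longleftrightarrow> m' = 0"
  shows "2 \<le> N (e (h, m) + e (h', m'))"
proof -
  define f where "f = (\<lambda>x. 1 * \<phi> (h, m) x + 1 * \<phi> (h', m') x)"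
  have "\<bar>f (e (h, m) + e (h', m'))\<bar> \<le> 1 * N (e (h, m) + e (h', m'))"
  proof (rule functional_N_bound[OF f_def i(1,2)])
    fix k g n assume k: "k \<in> carrier G" "g \<in> carrier G"
    have "\<bar>f (e (k, 0)) + f (e (k \<otimes> g, Suc n))\<bar> \<le> 1"
      using k i m by (auto simp: f_def \<phi>_e_J J_iff)
    then have "colour (g, n) * \<bar>f (e (k, 0)) + f (e (k \<otimes> g, Suc n))\<bar> \<le> 1 * 1"
      using colour_bounds[OF k(2), of n] by (intro mult_mono) auto
    then show "colour (g, n) * \<bar>f (e (k, 0)) + f (e (k \<otimes> g, Suc n))\<bar> \<le> 1" by simp
  qed (use i in \<open>auto simp: f_def \<phi>_e_J \<phi>_bond\<close>)
  moreover have "f (e (h, m) + e (h', m')) = 2"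
    using i by (auto simp: f_def linear_add[OF linear_phi] \<phi>_e_J)
  ultimately show ?thesis by linarith
qed

lemma N_opposite:
  assumes i: "i \<in> J" "j \<in> J" "i \<noteq> j"
  shows "4/3 \<le> N (e i - e j)"
proof -
  define f where "f = (\<lambda>x. 1 * \<phi> i x + (-1) * \<phi> j x)"
  have "\<bar>f (e i - e j)\<bar> \<le> 3/2 * N (e i - e j)"
  proof (rule functional_N_bound[OF f_def i(1,2)])
    fix k g n assume k: "k \<in> carrier G" "g \<in> carrier G"
    have "\<bar>f (e (k, 0)) + f (e (k \<otimes> g, Suc n))\<bar> \<le> 1"
      using k i by (auto simp: f_def \<phi>_e_J J_iff)
    then have "colour (g, n) * \<bar>f (e (k, 0)) + f (e (k \<otimes> g, Suc n))\<bar> \<le> 1 * 1"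
      using colour_bounds[OF k(2), of n] by (intro mult_mono) auto
    then show "colour (g, n) * \<bar>f (e (k, 0)) + f (e (k \<otimes> g, Suc n))\<bar> \<le> 3/2" by simp
  qed (use i in \<open>auto simp: f_def \<phi>_e_J \<phi>_bond\<close>)
  moreover have "f (e i - e j) = 2"
    using i by (auto simp: f_def linear_diff[OF linear_phi] \<phi>_e_J)
  ultimately show ?thesis by linarith
qed

text \<open>Norms of sums recover the coloured graph. The value \<open>1 / colour (g, n)\<close> lies strictly between 1 and \<open>4/3\<close>,
whereas two spikes \<open>\<sigma> *\<^sub>R e i\<close> and \<open>\<tau> *\<^sub>R e j\<close> that are not joined by a link have a sum
which is 0 or has norm at least \<open>4/3\<close>.\<close>

lemma decode_link:
  assumes \<sigma>: "\<bar>\<sigma>\<bar> = 1" "\<bar>\<tau>\<bar> = 1" and h: "h \<in> carrier G" "h' \<in> carrier G" "g \<in> carrier G"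
    and N: "N (\<sigma> *\<^sub>R e (h, m) + \<tau> *\<^sub>R e (h', m')) = 1 / colour (g, n)"
  shows "\<sigma> = \<tau> \<and> (m = 0 \<and> m' = Suc n \<and> h' = h \<otimes> g \<or> m' = 0 \<and> m = Suc n \<and> h = h' \<otimes> g)"
proof -
  have c: "4/5 \<le> colour (g, n)" "colour (g, n) \<le> 9/10" using colour_bounds[OF h(3)] by auto
  then have v: "1 < 1 / colour (g, n)" "1 / colour (g, n) < 4/3" by (auto simp: field_simps)
  have J: "(h, m) \<in> J" "(h', m') \<in> J" using h by (auto simp: J_iff)
  have ne: "(h, m) \<noteq> (h', m')"
  proof
    assume eq: "(h, m) = (h', m')"
    have "N (1 *\<^sub>R e (h, m)) = 1" using spike_sharp[OF J(1), of 1] unfolding sharp_def by simp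
    then have "N (\<sigma> *\<^sub>R e (h, m) + \<tau> *\<^sub>R e (h', m')) = \<bar>\<sigma> + \<tau>\<bar>"
      using N_scale[of "\<sigma> + \<tau>" "e (h, m)"] eq by (simp add: scaleR_add_left)
    then show False using N v abs_eq_1_cases[OF \<sigma>(1)] abs_eq_1_cases[OF \<sigma>(2)] by auto
  qed
  have sgn: "\<sigma> = \<tau>"
  proof (rule ccontr)
    assume "\<sigma> \<noteq> \<tau>"
    then have "\<tau> = - \<sigma>" using abs_eq_1_cases[OF \<sigma>(1)] abs_eq_1_cases[OF \<sigma>(2)] by auto
    then have "\<sigma> *\<^sub>R e (h, m) + \<tau> *\<^sub>R e (h', m') = \<sigma> *\<^sub>R (e (h, m) - e (h', m'))" by (simp add: scaleR_diff_right)
    then have "N (e (h, m) - e (h', m')) = 1 / colour (g, n)" using N \<sigma> by (simp add: N_scale)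
    then show False using N_opposite[OF J ne] v by linarith
  qed
  then have N': "N (e (h, m) + e (h', m')) = 1 / colour (g, n)"
    using N \<sigma> N_scale[of \<sigma> "e (h, m) + e (h', m')"] by (simp add: scaleR_add_right)
  have decode: "b = a \<otimes> g \<and> k = Suc n"
    if ab: "a \<in> carrier G" "b \<in> carrier G" "k \<noteq> 0" and N: "N (e (a, 0) + e (b, k)) = 1 / colour (g, n)" for a b k
  proof -
    obtain l where l: "k = Suc l" using ab(3) by (cases k) auto
    have b: "b = a \<otimes> (inv a \<otimes> b)" using ab by (simp add: m_assoc[symmetric])
    then have "N (e (a, 0) + e (b, k)) = 1 / colour (inv a \<otimes> b, l)"
      using N_link[of a "inv a \<otimes> b" l] ab l by simp
    then have "colour (g, n) = colour (inv a \<otimes> b, l)" using N v by (auto simp: field_simps)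
    then have "(g, n) = (inv a \<otimes> b, l)" using colour_inj h ab by (intro inj_onD[OF colour_inj]) auto
    then show ?thesis using b l by simp
  qed
  have "\<not> (m = 0 \<longleftrightarrow> m' = 0)" using N_unlinked[OF J ne] N' v by force
  then consider "m = 0" "m' \<noteq> 0" | "m' = 0" "m \<noteq> 0" by (cases "m = 0") auto
  then show ?thesis
  proof cases
    case 1 then show ?thesis using decode[of h h' m'] h N' sgn by simp
  next
    case 2 then show ?thesis using decode[of h' h m] h N' sgn by (simp add: add.commute)
  qed
qed

lemma N_w_le: "N (w n) \<le> 1/10"
proof -
  have "10 *\<^sub>R w n \<in> nbhd" using w_small[of n] \<kappa>(1) by (simp add: nbhd_def linear_scale[OF T_linear] T_w field_simps)
  then have "10 *\<^sub>R w n \<in> S" using core_sub_smooth unfolding S_def core_def by blast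
  then have "N (10 *\<^sub>R w n) \<le> 1" by (rule N_atom)
  then show ?thesis using N_scale[of 10 "w n"] by simp
qed

text \<open>The functional \<open>2/3 * (\<phi> (h, 0) - \<phi> (h, Suc n))\<close> is 1 at the bond, at most \<open>1 - \<eta>\<close> on the
smooth part, where the shrunk copy of the bond attains this value, and at most \<open>2/3\<close> at all other spikes and bonds.\<close>

lemma bond_isolated:
  assumes h: "h \<in> carrier G"
  shows "sharp N (\<eta> / 2) (bond h n)"
    and "s \<in> spikes \<union> bonds \<Longrightarrow> s \<noteq> bond h n \<Longrightarrow> 1/3 \<le> N (s - bond h n)"
proof -
  define f where "f = (\<lambda>x. (2/3) * \<phi> (h, 0) x + (-2/3) * \<phi> (h, Suc n) x)"
  have J: "(h, 0) \<in> J" "(h, Suc n) \<in> J" using h by (auto simp: J_iff)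
  have fbond: "f (bond h' n') = (if h = h' then (if n = n' then 1 else 1/2) else 0)" if "h' \<in> carrier G" for h' n'
    using J that by (simp add: f_def \<phi>_bond)
  have links: "colour (g, m) * \<bar>f (e (k, 0)) + f (e (k \<otimes> g, Suc m))\<bar> \<le> 1 - \<eta>"
    if k: "k \<in> carrier G" "g \<in> carrier G" for k g m
  proof -
    have "\<bar>f (e (k, 0)) + f (e (k \<otimes> g, Suc m))\<bar> \<le> 2/3"
      using k J by (auto simp: f_def \<phi>_e_J J_iff)
    then have "colour (g, m) * \<bar>f (e (k, 0)) + f (e (k \<otimes> g, Suc m))\<bar> \<le> 1 * (2/3)"
      using colour_bounds[OF k(2), of m] by (intro mult_mono) auto
    then show ?thesis using eta by simp
  qed
  have bnds: "(1 - \<eta>) * \<bar>f (bond h' n')\<bar> \<le> 1 - \<eta>" if "h' \<in> carrier G" for h' n'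
    using eta by (auto simp: fbond[OF that])
  note fb = functional_bound[OF f_def J _ links bnds]
  have lf: "linear f" by (rule fb) (use eta in auto)
  have S: "bond h n \<in> S" using h unfolding S_def bonds_def by (force intro!: exI[of _ "1::real"])
  have f1: "f (bond h n) = 1" using fbond[OF h] by simp
  have discrete: "f s \<le> 2/3" if s: "s \<in> spikes \<union> bonds" "s \<noteq> bond h n" for s
  proof -
    consider \<tau> l where "s = \<tau> *\<^sub>R e l" "\<bar>\<tau>\<bar> = 1" "l \<in> J"
      | \<tau> h' n' where "s = \<tau> *\<^sub>R bond h' n'" "\<bar>\<tau>\<bar> = 1" "h' \<in> carrier G"
      using s(1) unfolding spikes_def bonds_def by blast
    then show ?thesis
    proof cases
      case 1
      then have "f (e l) \<in> {0, 2/3, -2/3}" using J by (auto simp: f_def \<phi>_e_J)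
      then show ?thesis using 1 abs_eq_1_cases[OF 1(2)] by (auto simp: linear_scale[OF lf])
    next
      case 2
      then show ?thesis using s(2) abs_eq_1_cases[OF 2(2)] by (auto simp: linear_scale[OF lf] fbond)
    qed
  qed
  have gap: "f s \<le> 1 - 2 * (\<eta> / 2)" if "s \<in> S" "s \<noteq> bond h n" for s
  proof (cases "s \<in> smooth")
    case True
    then show ?thesis using fb(2)[of s] eta by auto
  next
    case False
    then show ?thesis using discrete[of s] that eta unfolding S_def by auto
  qed
  show "sharp N (\<eta> / 2) (bond h n)"
    by (rule isolated_atom_sharp[OF lf S f1 _ _ gap]) (use eta in auto)
  have "f s \<le> 1" if "s \<in> S" for s using gap[OF that] f1 eta by (cases "s = bond h n") auto
  then have fN: "\<bar>f x\<bar> \<le> N x" for x using functional_le_N[OF lf, of 1 x] by simp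
  show "1/3 \<le> N (s - bond h n)" if "s \<in> spikes \<union> bonds" "s \<noteq> bond h n"
    using fN[of "s - bond h n"] discrete[OF that] f1 by (simp add: linear_diff[OF lf])
qed

lemma isometry_spike:
  assumes V: "linear V" "surj V" "\<And>x. N (V x) = N x" and i: "i \<in> J"
  shows "\<exists>\<tau> h m. V (e i) = \<tau> *\<^sub>R e (h, m) \<and> \<bar>\<tau>\<bar> = 1 \<and> h \<in> carrier G"
proof -
  have "sharp N (1/20) (V (e i))" using sharp_isometry[OF V] spike_sharp[OF i, of 1] by simp
  then show ?thesis using sharp_imp_spike unfolding spikes_def J_def by blast
qed

text \<open>Spikes in the layers \<open>Suc n\<close> are recognised by their link to \<open>e (\<one>, 0)\<close>, then those in layer 0 by
their links to layer 1. The bonds follow because they are isolated sharp points which move by at most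
\<open>2 * N (w n) \<le> 1/5\<close>.\<close>

lemma isometry_fixing_base:
  assumes V: "linear V" "surj V" "\<And>x. N (V x) = N x" and V1: "V (e (\<one>, 0)) = e (\<one>, 0)"
  shows "V x = x"
proof -
  note spike = isometry_spike[OF V]
  have V_Suc: "V (e (g, Suc n)) = e (g, Suc n)" if g: "g \<in> carrier G" for g n
  proof -
    obtain \<tau> h m where tau: "V (e (g, Suc n)) = \<tau> *\<^sub>R e (h, m)" "\<bar>\<tau>\<bar> = 1" "h \<in> carrier G"
      using spike[of "(g, Suc n)"] g by (auto simp: J_iff)
    have "N (V (e (\<one>, 0) + e (\<one> \<otimes> g, Suc n))) = 1 / colour (g, n)" using V(3) N_link[of \<one> g n] g by simp
    then have "N (1 *\<^sub>R e (\<one>, 0) + \<tau> *\<^sub>R e (h, m)) = 1 / colour (g, n)"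
      using g tau V1 by (simp add: linear_add[OF V(1)])
    from decode_link[OF _ tau(2) _ tau(3) g this] show ?thesis using tau g by auto
  qed
  have V_0: "V (e (k, 0)) = e (k, 0)" if k: "k \<in> carrier G" for k
  proof -
    obtain \<tau> h m where tau: "V (e (k, 0)) = \<tau> *\<^sub>R e (h, m)" "\<bar>\<tau>\<bar> = 1" "h \<in> carrier G"
      using spike[of "(k, 0)"] k by (auto simp: J_iff)
    have "N (V (e (k, 0) + e (k \<otimes> \<one>, Suc 0))) = 1 / colour (\<one>, 0)" using V(3) N_link[of k \<one> 0] k by simp
    then have "N (\<tau> *\<^sub>R e (h, m) + 1 *\<^sub>R e (k, Suc 0)) = 1 / colour (\<one>, 0)"
      using k tau V_Suc by (simp add: linear_add[OF V(1)])
    from decode_link[OF tau(2) _ tau(3) k _ this] show ?thesis using tau k by auto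
  qed
  have V_e: "V (e i) = e i" if "i \<in> J" for i
    using that V_Suc V_0 by (cases i; cases "snd i") (auto simp: J_iff)
  have V_w: "V (w n) = w n" for n
  proof -
    let ?b = "bond \<one> n"
    define u where "u = V ?b"
    have diff: "u - ?b = V (w n) - w n"
      unfolding u_def bond_def by (simp add: linear_add[OF V(1)] linear_diff[OF V(1)] linear_scale[OF V(1)] V_e J_iff)
    have near: "N (u - ?b) \<le> 1/5"
      using N_triangle[of "V (w n)" "- w n"] V(3)[of "w n"] N_w_le[of n] N_uminus[of "w n"] diff by simp
    have u: "sharp N (\<eta> / 2) u" unfolding u_def using sharp_isometry[OF V bond_isolated(1)] by simp
    define \<epsilon> where "\<epsilon> = min (1/10) ((\<eta> / 2)\<^sup>2 * \<nu>\<^sup>2 / 4)"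
    have pos: "0 < (\<eta> / 2)\<^sup>2 * \<nu>\<^sup>2" using eta nu by simp
    have eps: "0 < \<epsilon>" "\<epsilon> \<le> 1/10" "\<epsilon> \<le> (\<eta> / 2)\<^sup>2 * \<nu>\<^sup>2 / 4" using pos by (auto simp: \<epsilon>_def)
    have "\<exists>s\<in>{?b}. N (s - u) \<le> d" if d: "0 < d" "d \<le> \<epsilon>" for d
    proof -
      obtain s where s: "s \<in> S" "N (s - u) \<le> d" using sharp_near_atom[OF u _ d(1)] eta by auto
      have "s \<notin> smooth" using sharp_far_from_smooth[OF u, of s] s eta d eps pos by fastforce
      moreover have "N (s - ?b) \<le> 3/10" using N_triangle_diff[of s ?b u] near s d eps by linarith
      ultimately have "s = ?b" using bond_isolated(2)[of \<one> s n] s unfolding S_def by fastforce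
      then show ?thesis using s by simp
    qed
    then have "u \<in> {?b}" by (rule separated_limit[OF eps(1), where d = "3 * \<epsilon>"]) (use eps in auto)
    then show ?thesis using diff by simp
  qed
  have bl: "bounded_linear V"
  proof (rule bounded_linear_intro[where K = "R * (4 * \<kappa> * M)"])
    fix x
    have "norm (V x) \<le> R * N x" using norm_le_N[of "V x"] V(3) by simp
    also have "\<dots> \<le> R * (norm x / (1 / (4 * \<kappa> * M)))" using N_le_norm R by (intro mult_left_mono) auto
    finally show "norm (V x) \<le> norm x * (R * (4 * \<kappa> * M))" by (simp add: mult_ac)
  qed (simp_all add: linear_add[OF V(1)] linear_scale[OF V(1)])
  have "closed {x. V x = x}"
    by (intro closed_Collect_eq continuous_intros linear_continuous_on[OF bl])
  moreover have "subspace {x. V x = x}"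
    by (simp add: subspace_def linear_0[OF V(1)] linear_add[OF V(1)] linear_scale[OF V(1)])
  then have "span (e ` (carrier G \<times> UNIV) \<union> range w) \<subseteq> {x. V x = x}"
    using V_e V_w by (intro span_minimal) (auto simp: J_def)
  ultimately have "closure (span (e ` (carrier G \<times> UNIV) \<union> range w)) \<subseteq> {x. V x = x}"
    by (rule closure_minimal[rotated])
  then show ?thesis using dense by auto
qed

lemma isometry_classification:
  assumes V: "linear V" "surj V" "\<And>x. N (V x) = N x"
  obtains \<sigma> h where "\<bar>\<sigma>\<bar> = 1" "h \<in> carrier G" "\<And>x. V x = \<sigma> *\<^sub>R T h x"
proof -
  note spike = isometry_spike[OF V]
  obtain \<sigma> h m where V1: "V (e (\<one>, 0)) = \<sigma> *\<^sub>R e (h, m)" "\<bar>\<sigma>\<bar> = 1" "h \<in> carrier G"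
    using spike[of "(\<one>, 0)"] by (auto simp: J_iff)
  (* The base spike has links of all colours (\<one>, n), while a spike in layer Suc n has only those with this n. *)
  (* Two different colours therefore exclude that the image of the base spike lies in a positive layer. *)
  have "m = 0 \<or> m = Suc n" for n
  proof -
    obtain \<tau> h' m' where tau: "V (e (\<one>, Suc n)) = \<tau> *\<^sub>R e (h', m')" "\<bar>\<tau>\<bar> = 1" "h' \<in> carrier G"
      using spike[of "(\<one>, Suc n)"] by (auto simp: J_iff)
    have "N (V (e (\<one>, 0) + e (\<one> \<otimes> \<one>, Suc n))) = 1 / colour (\<one>, n)" using V(3) N_link[of \<one> \<one> n] by simp
    then have "N (\<sigma> *\<^sub>R e (h, m) + \<tau> *\<^sub>R e (h', m')) = 1 / colour (\<one>, n)"
      using V1 tau by (simp add: linear_add[OF V(1)])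
    from decode_link[OF V1(2) tau(2) V1(3) tau(3) _ this] show ?thesis by auto
  qed
  from this[of 0] this[of 1] have m: "m = 0" by auto
  have \<sigma>2: "\<sigma> * \<sigma> = 1" using abs_eq_1_cases[OF V1(2)] by auto
  define V' where "V' x = \<sigma> *\<^sub>R T (inv h) (V x)" for x
  have Tinv: "linear (T (inv h))" using T_linear V1(3) by simp
  have "V' x = x" for x
  proof (rule isometry_fixing_base)
    show "linear V'" unfolding V'_def
      by (rule linearI) (simp_all add: linear_add[OF V(1)] linear_add[OF Tinv] linear_scale[OF V(1)] linear_scale[OF Tinv] scaleR_add_right)
    show "N (V' x) = N x" for x unfolding V'_def using V1 V(3) T_isometry by (simp add: N_scale)
    show "V' (e (\<one>, 0)) = e (\<one>, 0)"
      unfolding V'_def using V1 m \<sigma>2 by (simp add: linear_scale[OF Tinv] T_e)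
    show "surj V'"
    proof (rule surjI)
      fix y
      have "V (inv_into UNIV V (\<sigma> *\<^sub>R T h y)) = \<sigma> *\<^sub>R T h y" using V(2) by (rule surj_f_inv_f)
      then show "V' (inv_into UNIV V (\<sigma> *\<^sub>R T h y)) = y"
        unfolding V'_def using V1(3) \<sigma>2 by (simp add: linear_scale[OF Tinv] T_mult T_one)
    qed
  qed
  then have "V x = \<sigma> *\<^sub>R T h x" for x
  proof -
    assume "\<And>x. V' x = x"
    then have "T h (\<sigma> *\<^sub>R T (inv h) (V x)) = T h x" unfolding V'_def by simp
    then have "\<sigma> *\<^sub>R V x = T h x" using V1(3) by (simp add: linear_scale[OF T_linear] T_mult T_one)
    then have "\<sigma> *\<^sub>R \<sigma> *\<^sub>R V x = \<sigma> *\<^sub>R T h x" by simp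
    then show ?thesis using \<sigma>2 by simp
  qed
  then show ?thesis using that V1 by blast
qed

lemma signed_group_representable: "representable (sign_img \<times>\<times> G) TYPE('a)"
proof -
  define \<psi> where "\<psi> = (\<lambda>(\<sigma>::int, g). \<lambda>x. real_of_int \<sigma> *\<^sub>R T g x)"
  have grp: "group (sign_img \<times>\<times> G)" by (intro DirProd_group sign_img_is_group group_axioms)
  have car: "carrier (sign_img \<times>\<times> G) = {-1, 1} \<times> carrier G" by (simp add: DirProd_def sign_img_def)
  have isom: "\<psi> a \<in> carrier (isometry_group N)" if a: "a \<in> carrier (sign_img \<times>\<times> G)" for a
  proof -
    obtain \<sigma> g where ag: "a = (\<sigma>, g)" "\<sigma> \<in> {-1, 1}" "g \<in> carrier G" using a car by auto
    then have s: "\<bar>real_of_int \<sigma>\<bar> = 1" "real_of_int \<sigma> * real_of_int \<sigma> = 1" by auto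
    have "linear (\<psi> a)" unfolding \<psi>_def ag using ag(3)
      by (intro linearI) (simp_all add: linear_add[OF T_linear] linear_scale[OF T_linear] scaleR_add_right)
    moreover have "\<psi> a (real_of_int \<sigma> *\<^sub>R T (inv g) x) = x" for x
      unfolding \<psi>_def ag using ag(3) s by (simp add: linear_scale[OF T_linear] T_mult T_one)
    then have "surj (\<psi> a)" by (rule surjI)
    moreover have "N (\<psi> a x) = N x" for x unfolding \<psi>_def ag using ag(3) s T_isometry by (simp add: N_scale)
    ultimately show ?thesis by (simp add: isometry_group_def)
  qed
  have "\<psi> \<in> hom (sign_img \<times>\<times> G) (isometry_group N)"
  proof (rule homI)
    show "\<psi> (a \<otimes>\<^bsub>sign_img \<times>\<times> G\<^esub> b) = \<psi> a \<otimes>\<^bsub>isometry_group N\<^esub> \<psi> b"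
      if "a \<in> carrier (sign_img \<times>\<times> G)" "b \<in> carrier (sign_img \<times>\<times> G)" for a b
      using that by (auto simp: \<psi>_def isometry_group_def car DirProd_def sign_img_def fun_eq_iff
        linear_scale[OF T_linear] linear_neg[OF T_linear] T_mult)
  qed (rule isom)
  moreover have "inj_on \<psi> (carrier (sign_img \<times>\<times> G))"
  proof (rule inj_onI)
    fix a b assume ab: "a \<in> carrier (sign_img \<times>\<times> G)" "b \<in> carrier (sign_img \<times>\<times> G)" "\<psi> a = \<psi> b"
    obtain \<sigma> g where a: "a = (\<sigma>, g)" "\<sigma> \<in> {-1, 1}" "g \<in> carrier G" using ab car by auto
    obtain \<tau> h where b: "b = (\<tau>, h)" "\<tau> \<in> {-1, 1}" "h \<in> carrier G" using ab car by auto
    have "\<psi> a (e (\<one>, 0)) = \<psi> b (e (\<one>, 0))" using ab by simp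
    then have "real_of_int \<sigma> *\<^sub>R e (g, 0) = real_of_int \<tau> *\<^sub>R e (h, 0)"
      using a b by (simp add: \<psi>_def T_e)
    then have "\<phi> (g, 0) (real_of_int \<sigma> *\<^sub>R e (g, 0)) = \<phi> (g, 0) (real_of_int \<tau> *\<^sub>R e (h, 0))" by simp
    then show "a = b" using a b by (auto simp: linear_scale[OF linear_phi] \<phi>_e_J J_iff split: if_splits)
  qed
  moreover have "\<psi> ` carrier (sign_img \<times>\<times> G) = carrier (isometry_group N)"
  proof
    show "carrier (isometry_group N) \<subseteq> \<psi> ` carrier (sign_img \<times>\<times> G)"
    proof
      fix V assume "V \<in> carrier (isometry_group N)"
      then have V: "linear V" "surj V" "\<And>x. N (V x) = N x" by (auto simp: isometry_group_def)
      obtain \<sigma> h where s: "\<bar>\<sigma>\<bar> = 1" "h \<in> carrier G" "\<And>x. V x = \<sigma> *\<^sub>R T h x"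
        using isometry_classification[OF V] by blast
      then have "V = \<psi> (if \<sigma> = 1 then 1 else -1, h)" using abs_eq_1_cases[OF s(1)] by (auto simp: \<psi>_def fun_eq_iff)
      moreover have "(if \<sigma> = 1 then 1 else -1, h) \<in> carrier (sign_img \<times>\<times> G)" unfolding car using s by simp
      ultimately show "V \<in> \<psi> ` carrier (sign_img \<times>\<times> G)" by blast
    qed
  qed (use isom in auto)
  ultimately have "\<psi> \<in> iso (sign_img \<times>\<times> G) (isometry_group N)"
    by (simp add: iso_def bij_betw_def)
  then have "(sign_img \<times>\<times> G) \<cong> isometry_group N" unfolding is_iso_def by blast
  then have "isometry_group N \<cong> (sign_img \<times>\<times> G)" by (rule group.iso_sym[OF grp])
  then show ?thesis unfolding representable_def using equivalent_norm_N by blast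
qed

end

section \<open>Coordinates of a complemented basis\<close>

text \<open>Zabreiko's lemma. By Baire's theorem some sublevel set of \<open>q\<close> is dense in a ball, so every vector of
a smaller ball is the sum of a series in which the values of \<open>q\<close> decay geometrically. It will replace the open
mapping theorem in the proof that the partial sums of a basis expansion are uniformly bounded.\<close>

lemma countably_subadditive_seminorm_bounded:
  fixes q :: "'a::banach \<Rightarrow> real"
  assumes nonneg: "\<And>x. 0 \<le> q x"
    and scale: "\<And>c x. q (c *\<^sub>R x) \<le> \<bar>c\<bar> * q x"
    and triangle: "\<And>x y. q (x + y) \<le> q x + q y"
    and series: "\<And>X x. X sums x \<Longrightarrow> summable (\<lambda>n. norm (X n)) \<Longrightarrow> summable (\<lambda>n. q (X n)) \<Longrightarrow>
      q x \<le> (\<Sum>n. q (X n))"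
  obtains K where "0 < K" "\<And>x. q x \<le> K * norm x"
proof -
  define A where "A n = {x. q x \<le> real n}" for n :: nat
  have "\<exists>n. interior (closure (A n)) \<noteq> {}"
  proof (rule ccontr)
    assume *: "\<not> ?thesis"
    have "(euclidean :: 'a topology) interior_of \<Union>(range (\<lambda>n. closure (A n))) = {}"
      by (rule Baire_category_alt) (use * completely_metrizable_space_euclidean in auto)
    moreover have "x \<in> closure (A (nat \<lceil>q x\<rceil>))" for x
      by (rule subsetD[OF closure_subset]) (use nonneg[of x] in \<open>auto simp: A_def\<close>)
    then have "\<Union>(range (\<lambda>n. closure (A n))) = UNIV" by auto
    ultimately show False by simp
  qed
  then obtain n z where "z \<in> interior (closure (A n))" by blast
  then obtain r where r: "0 < r" "ball z r \<subseteq> closure (A n)"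
    by (meson mem_interior)
  define \<rho> where "\<rho> = r / 2"
  have \<rho>: "0 < \<rho>" "\<rho> < r" using r by (auto simp: \<rho>_def)
  have near: "\<exists>a. q a \<le> n \<and> norm (x - a) \<le> d" if x: "norm x \<le> \<rho>" and d: "0 < d" for x d
  proof -
    have "z + x \<in> closure (A n)" "z - x \<in> closure (A n)" using x \<rho> r(2) by (auto simp: subset_eq dist_norm)
    then obtain a b where ab: "a \<in> A n" "dist a (z + x) < d" "b \<in> A n" "dist b (z - x) < d"
      using d by (meson closure_approachable)
    have "q ((1/2) *\<^sub>R (a + (-1) *\<^sub>R b)) \<le> 1/2 * (q a + q ((-1) *\<^sub>R b))"
      using scale[of "1/2" "a + (-1) *\<^sub>R b"] triangle[of a "(-1) *\<^sub>R b"] by simp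
    also have "\<dots> \<le> 1/2 * (n + n)" using ab scale[of "-1" b] by (auto simp: A_def)
    finally have 1: "q ((1/2) *\<^sub>R (a + (-1) *\<^sub>R b)) \<le> n" by simp
    have "x - (1/2) *\<^sub>R (a + (-1) *\<^sub>R b) = (1/2) *\<^sub>R (((z + x) - a) - ((z - x) - b))"
      by (simp add: algebra_simps scaleR_2[symmetric] flip: scaleR_add_left)
    then have "norm (x - (1/2) *\<^sub>R (a + (-1) *\<^sub>R b)) = 1/2 * norm (((z + x) - a) - ((z - x) - b))" by simp
    also have "\<dots> \<le> 1/2 * (norm ((z + x) - a) + norm ((z - x) - b))"
      by (intro mult_left_mono norm_triangle_ineq4) auto
    also have "\<dots> \<le> d" using ab by (simp add: dist_norm norm_minus_commute)
    finally show ?thesis using 1 by blast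
  qed
  have step: "\<exists>a. q a \<le> n * (1/2)^j \<and> norm (x - a) \<le> \<rho> * (1/2)^Suc j" if x: "norm x \<le> \<rho> * (1/2)^j" for x j
  proof -
    have "norm (2^j *\<^sub>R x) \<le> \<rho>" using x by (simp add: field_simps power_one_over)
    then obtain a where a: "q a \<le> n" "norm (2^j *\<^sub>R x - a) \<le> \<rho> / 2" using near[of "2^j *\<^sub>R x" "\<rho>/2"] \<rho> by auto
    have "q ((1/2)^j *\<^sub>R a) \<le> (1/2)^j * q a" using scale[of "(1/2)^j" a] by simp
    also have "\<dots> \<le> (1/2)^j * n" using a by (intro mult_left_mono) auto
    finally have 1: "q ((1/2)^j *\<^sub>R a) \<le> n * (1/2)^j" by (simp add: mult.commute)
    have "x - (1/2)^j *\<^sub>R a = (1/2)^j *\<^sub>R (2^j *\<^sub>R x - a)" by (simp add: algebra_simps power_one_over)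
    then have "norm (x - (1/2)^j *\<^sub>R a) = (1/2)^j * norm (2^j *\<^sub>R x - a)" by simp
    also have "\<dots> \<le> (1/2)^j * (\<rho> / 2)" using a by (intro mult_left_mono) auto
    finally show ?thesis using 1 by (intro exI[of _ "(1/2)^j *\<^sub>R a"]) (simp add: mult.commute)
  qed
  then obtain F where F: "\<And>x j. norm x \<le> \<rho> * (1/2)^j \<Longrightarrow> q (F x j) \<le> n * (1/2)^j \<and> norm (x - F x j) \<le> \<rho> * (1/2)^Suc j"
    by metis
  have ball: "q x \<le> 2 * n" if x: "norm x \<le> \<rho>" for x
  proof -
    define Y where "Y = rec_nat x (\<lambda>j y. y - F y j)"
    have Y0: "Y 0 = x" and YS: "Y (Suc j) = Y j - F (Y j) j" for j by (auto simp: Y_def)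
    have Y: "norm (Y j) \<le> \<rho> * (1/2)^j" for j
      by (induction j) (use x F in \<open>auto simp: Y0 YS\<close>)
    define X where "X j = F (Y j) j" for j
    have qX: "q (X j) \<le> n * (1/2)^j" for j using F[OF Y] by (simp add: X_def)
    have nX: "norm (X j) \<le> 2 * \<rho> * (1/2)^j" for j
    proof -
      have "X j = Y j - Y (Suc j)" by (simp add: X_def YS)
      then have "norm (X j) \<le> norm (Y j) + norm (Y (Suc j))" using norm_triangle_ineq4 by metis
      also have "\<dots> \<le> \<rho> * (1/2)^j + \<rho> * (1/2)^Suc j" by (intro add_mono Y)
      also have "\<dots> \<le> 2 * \<rho> * (1/2)^j" using \<rho> by simp
      finally show ?thesis .
    qed
    have geo: "summable (\<lambda>j. c * (1/2::real)^j)" for c by (intro summable_mult summable_geometric) auto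
    have sumX: "(\<Sum>j<k. X j) = x - Y k" for k by (induction k) (auto simp: Y0 YS X_def)
    have "Y \<longlonglongrightarrow> 0"
    proof (rule Lim_null_comparison[of _ "\<lambda>j. \<rho> * (1/2)^j"])
      show "(\<lambda>j. \<rho> * (1/2)^j) \<longlonglongrightarrow> 0" by (intro tendsto_mult_right_zero LIMSEQ_power_zero) auto
    qed (use Y in auto)
    then have "(\<lambda>k. x - Y k) \<longlonglongrightarrow> x - 0" by (intro tendsto_intros)
    then have "X sums x" unfolding sums_def sumX by simp
    moreover have "summable (\<lambda>j. norm (X j))"
      by (rule summable_comparison_test'[OF geo[of "2 * \<rho>"], of 0]) (use nX in auto)
    moreover have sq: "summable (\<lambda>j. q (X j))"
      by (rule summable_comparison_test'[OF geo[of n], of 0]) (use qX nonneg in auto)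
    ultimately have "q x \<le> (\<Sum>j. q (X j))" by (rule series)
    also have "\<dots> \<le> (\<Sum>j. n * (1/2)^j)" by (intro suminf_le qX sq geo)
    also have "\<dots> = 2 * n" by (simp add: suminf_mult suminf_geometric)
    finally show ?thesis .
  qed
  have "q x \<le> (2 * n / \<rho> + 1) * norm x" for x
  proof (cases "x = 0")
    case True
    then show ?thesis using scale[of 0 x] by simp
  next
    case False
    have "q x = q ((norm x / \<rho>) *\<^sub>R ((\<rho> / norm x) *\<^sub>R x))" using False \<rho> by simp
    also have "\<dots> \<le> norm x / \<rho> * q ((\<rho> / norm x) *\<^sub>R x)"
      using scale[of "norm x / \<rho>" "(\<rho> / norm x) *\<^sub>R x"] \<rho> by simp
    also have "\<dots> \<le> norm x / \<rho> * (2 * n)" using \<rho> False by (intro mult_left_mono ball) auto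
    also have "\<dots> \<le> (2 * n / \<rho> + 1) * norm x" by (simp add: algebra_simps)
    finally show ?thesis .
  qed
  moreover have "0 < 2 * n / \<rho> + 1" using \<rho> by (simp add: add_nonneg_pos)
  ultimately show ?thesis using that by blast
qed

text \<open>Composition with \<open>P\<close> turns the coordinates into functionals on the whole space, which is complete, so that
Baire's theorem can be applied there.\<close>

locale complemented_basis =
  fixes P :: "'a::banach \<Rightarrow> 'a" and s :: "nat \<Rightarrow> 'a"
  assumes P_bl: "bounded_linear P" and P_idem: "P (P x) = P x"
    and basis: "schauder_basis s (range P)"
begin

sublocale P: bounded_linear P by (rule P_bl)

definition coord :: "'a \<Rightarrow> nat \<Rightarrow> real" where
  "coord x = (THE a. (\<lambda>n. a n *\<^sub>R s n) sums P x)"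

lemma expansion_ex1: "\<exists>!a. (\<lambda>n. a n *\<^sub>R s n) sums P x"
  using basis unfolding schauder_basis_def by blast

lemma coord_sums: "(\<lambda>n. coord x n *\<^sub>R s n) sums P x"
  unfolding coord_def by (rule theI'[OF expansion_ex1])

lemma coord_unique: "(\<lambda>n. a n *\<^sub>R s n) sums P x \<Longrightarrow> coord x = a"
  unfolding coord_def using expansion_ex1 by (rule the1_equality)

lemma P_s: "P (s n) = s n"
  using basis P_idem unfolding schauder_basis_def by (metis image_iff range_subsetD)

lemma coord_add: "coord (x + y) n = coord x n + coord y n"
proof -
  have "coord (x + y) = (\<lambda>n. coord x n + coord y n)"
    by (rule coord_unique) (use sums_add[OF coord_sums[of x] coord_sums[of y]] in \<open>simp add: P.add scaleR_add_left\<close>)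
  then show ?thesis by simp
qed

lemma coord_scale: "coord (c *\<^sub>R x) n = c * coord x n"
proof -
  have "coord (c *\<^sub>R x) = (\<lambda>n. c * coord x n)"
    by (rule coord_unique) (use sums_scaleR_right[OF coord_sums[of x], of c] in \<open>simp add: P.scaleR\<close>)
  then show ?thesis by simp
qed

lemma linear_coord: "linear (\<lambda>x. coord x n)"
  by (rule linearI) (auto simp: coord_add coord_scale)

lemma coord_P: "coord (P x) = coord x"
  by (rule coord_unique) (simp add: P_idem coord_sums)

lemma coord_s: "coord (s m) n = (if n = m then 1 else 0)"
proof -
  have "coord (s m) = (\<lambda>n. if n = m then 1 else 0)"
  proof (rule coord_unique)
    have "(\<lambda>n. (if n = m then 1 else 0) *\<^sub>R s n) = (\<lambda>n. if n = m then s n else 0)" by auto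
    then show "(\<lambda>n. (if n = m then 1 else 0) *\<^sub>R s n) sums P (s m)"
      using sums_single[of m s] by (simp add: P_s)
  qed
  then show ?thesis by simp
qed

lemma s_nonzero: "s n \<noteq> 0"
  using coord_s[of n n] linear_0[OF linear_coord, of n] by auto

lemma P_eqI: "coord x = coord y \<Longrightarrow> P x = P y"
  using coord_sums[of x] coord_sums[of y] sums_unique2 by metis

definition partial :: "nat \<Rightarrow> 'a \<Rightarrow> 'a" where
  "partial k x = (\<Sum>n<k. coord x n *\<^sub>R s n)"

lemma linear_partial: "linear (partial k)"
  by (rule linearI) (auto simp: partial_def coord_add coord_scale scaleR_add_left sum.distrib scaleR_sum_right)

lemma partial_lim: "(\<lambda>k. partial k x) \<longlonglongrightarrow> P x"
  using coord_sums[of x] by (simp add: sums_def partial_def)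

lemma partial_Suc: "partial (Suc k) x = partial k x + coord x k *\<^sub>R s k"
  by (simp add: partial_def)

text \<open>The supremum of the norms of the partial sums is a seminorm to which Zabreiko's lemma applies. For
countable subadditivity, let \<open>x\<close> be the sum of \<open>X j\<close> with \<open>q (X j)\<close> summable. The coordinates of the \<open>X j\<close> can
be added up, and dominated convergence identifies the sums as the coordinates of \<open>x\<close>.\<close>

lemma basis_constant:
  obtains K where "0 < K" "\<And>k x. norm (partial k x) \<le> K * norm x"
proof -
  define q where "q x = (SUP k. norm (partial k x))" for x
  have bdd: "bdd_above (range (\<lambda>k. norm (partial k x)))" for x
  proof -
    have "Bseq (\<lambda>k. partial k x)" using partial_lim by (intro convergent_imp_Bseq) (auto simp: convergent_def)
    then show ?thesis by (metis Bseq_def bdd_aboveI2)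
  qed
  have le_q: "norm (partial k x) \<le> q x" for k x unfolding q_def by (rule cSUP_upper[OF _ bdd]) auto
  have q_le: "q x \<le> c" if "\<And>k. norm (partial k x) \<le> c" for x c unfolding q_def using that by (intro cSUP_least) auto
  have P_q: "norm (P x) \<le> q x" for x
    by (rule LIMSEQ_le_const2[OF tendsto_norm[OF partial_lim]]) (use le_q in auto)
  have q0: "0 \<le> q x" for x using le_q[of 0 x] by (metis norm_ge_zero order_trans)
  have co: "norm (coord x i *\<^sub>R s i) \<le> 2 * q x" for x i
  proof -
    have "norm (partial (Suc i) x - partial i x) \<le> norm (partial (Suc i) x) + norm (partial i x)" by (rule norm_triangle_ineq4)
    then show ?thesis using le_q[of "Suc i" x] le_q[of i x] by (simp add: partial_Suc)
  qed
  have series: "q x \<le> (\<Sum>j. q (X j))"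
    if X: "X sums x" and sq: "summable (\<lambda>j. q (X j))" for X x
  proof -
    have sc: "summable (\<lambda>j. coord (X j) i)" for i
    proof (rule summable_norm_cancel, rule summable_comparison_test'[OF summable_mult[OF sq, of "2 / norm (s i)"], of 0])
      show "norm (norm (coord (X j) i)) \<le> 2 / norm (s i) * q (X j)" for j
        using co[of "X j" i] s_nonzero[of i] by (simp add: field_simps)
    qed
    define b where "b i = (\<Sum>j. coord (X j) i)" for i
    have ps: "(\<lambda>j. partial k (X j)) sums (\<Sum>i<k. b i *\<^sub>R s i)" for k
      unfolding partial_def b_def by (intro sums_sum sums_scaleR_left summable_sums sc)
    have PX: "(\<lambda>j. P (X j)) sums P x" by (rule P.sums[OF X])
    have "(\<lambda>k. \<Sum>j. norm (partial k (X j) - P (X j))) \<longlonglongrightarrow> (\<Sum>j::nat. 0)"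
      and ev: "\<forall>\<^sub>F k in sequentially. summable (\<lambda>j. norm (norm (partial k (X j) - P (X j))))"
    proof -
      have "((\<lambda>k. norm (partial k (X j) - P (X j))) \<longlongrightarrow> 0) sequentially" for j
        using tendsto_diff[OF partial_lim[of "X j"] tendsto_const[of "P (X j)"]] by (simp add: tendsto_norm_zero)
      moreover have "norm (norm (partial k (X j) - P (X j))) \<le> 2 * q (X j)" for k j
        using norm_triangle_ineq4[of "partial k (X j)" "P (X j)"] le_q[of k "X j"] P_q[of "X j"] by simp
      ultimately have *: "eventually (\<lambda>k. summable (\<lambda>j. norm (norm (partial k (X j) - P (X j))))) sequentially \<and>
           summable (\<lambda>j::nat. norm (0::real)) \<and>
           ((\<lambda>k. \<Sum>j. norm (partial k (X j) - P (X j))) \<longlongrightarrow> (\<Sum>j::nat. 0)) sequentially"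
        by (intro tannerys_theorem[where M = "\<lambda>j. 2 * q (X j)"] summable_mult sq always_eventually) auto
      show "(\<lambda>k. \<Sum>j. norm (partial k (X j) - P (X j))) \<longlonglongrightarrow> (\<Sum>j::nat. 0)"
        "\<forall>\<^sub>F k in sequentially. summable (\<lambda>j. norm (norm (partial k (X j) - P (X j))))" using * by blast+
    qed
    then have lim0: "(\<lambda>k. \<Sum>j. norm (partial k (X j) - P (X j))) \<longlonglongrightarrow> 0" by simp
    have "(\<lambda>k. (\<Sum>i<k. b i *\<^sub>R s i) - P x) \<longlonglongrightarrow> 0"
    proof (rule Lim_null_comparison[OF _ lim0])
      show "\<forall>\<^sub>F k in sequentially. norm ((\<Sum>i<k. b i *\<^sub>R s i) - P x) \<le> (\<Sum>j. norm (partial k (X j) - P (X j)))"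
        using ev
      proof eventually_elim
        case (elim k)
        have "(\<Sum>i<k. b i *\<^sub>R s i) - P x = (\<Sum>j. partial k (X j) - P (X j))"
          using sums_diff[OF ps[of k] PX] by (simp add: sums_unique)
        then show ?case using summable_norm[of "\<lambda>j. partial k (X j) - P (X j)"] elim by simp
      qed
    qed
    then have "(\<lambda>i. b i *\<^sub>R s i) sums P x" unfolding sums_def by (rule LIM_zero_cancel)
    then have cb: "coord x = b" by (rule coord_unique)
    show ?thesis
    proof (rule q_le)
      fix k
      have sn: "summable (\<lambda>j. norm (partial k (X j)))"
        by (rule summable_comparison_test'[OF sq, of 0]) (use le_q in auto)
      have "partial k x = (\<Sum>j. partial k (X j))" using ps[of k] by (simp add: partial_def cb sums_unique)
      then have "norm (partial k x) \<le> (\<Sum>j. norm (partial k (X j)))" using summable_norm[OF sn] by simp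
      also have "\<dots> \<le> (\<Sum>j. q (X j))" by (intro suminf_le le_q sn sq)
      finally show "norm (partial k x) \<le> (\<Sum>j. q (X j))" .
    qed
  qed
  obtain K where K: "0 < K" "\<And>x. q x \<le> K * norm x"
  proof (rule countably_subadditive_seminorm_bounded[of q])
    show "0 \<le> q x" for x by (rule q0)
    show "q (c *\<^sub>R x) \<le> \<bar>c\<bar> * q x" for c x
      by (rule q_le) (simp add: linear_scale[OF linear_partial] mult_left_mono le_q)
    show "q (x + y) \<le> q x + q y" for x y
      by (rule q_le) (metis linear_add[OF linear_partial] norm_triangle_ineq add_mono le_q order_trans)
    show "q x \<le> (\<Sum>n. q (X n))" if "X sums x" "summable (\<lambda>n. q (X n))" for X x using series that .
  qed blast
  show ?thesis using that[OF K(1)] K(2) le_q by (meson order_trans)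
qed

definition basis_const where "basis_const = (SOME K. 0 < K \<and> (\<forall>k x. norm (partial k x) \<le> K * norm x))"

lemma basis_const: "0 < basis_const" "norm (partial k x) \<le> basis_const * norm x"
proof -
  have "\<exists>K. 0 < K \<and> (\<forall>k x. norm (partial k x) \<le> K * norm x)" using basis_constant by metis
  from someI_ex[OF this] show "0 < basis_const" "norm (partial k x) \<le> basis_const * norm x" unfolding basis_const_def by auto
qed

lemma coord_bound: "\<bar>coord x i\<bar> * norm (s i) \<le> 2 * basis_const * norm x"
proof -
  have "norm (partial (Suc i) x - partial i x) \<le> norm (partial (Suc i) x) + norm (partial i x)" by (rule norm_triangle_ineq4)
  then show ?thesis using basis_const(2)[of "Suc i" x] basis_const(2)[of i x] by (simp add: partial_Suc)
qed

lemma bounded_linear_coord: "bounded_linear (\<lambda>x. coord x i)"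
proof (rule bounded_linear_intro[where K = "2 * basis_const / norm (s i)"])
  show "norm (coord x i) \<le> norm x * (2 * basis_const / norm (s i))" for x
    using coord_bound[of x i] s_nonzero[of i] by (simp add: field_simps)
qed (auto simp: coord_add coord_scale)

lemma coord_sum: "finite A \<Longrightarrow> coord (\<Sum>i\<in>A. a i *\<^sub>R s i) n = (if n \<in> A then a n else 0)"
proof -
  assume A: "finite A"
  have "coord (\<Sum>i\<in>A. a i *\<^sub>R s i) n = (\<Sum>i\<in>A. a i * (if n = i then 1 else 0))"
    using linear_sum[OF linear_coord[of n], of "\<lambda>i. a i *\<^sub>R s i" A] by (simp add: coord_scale coord_s)
  then show ?thesis using A by (simp add: if_distrib sum.delta' cong: if_cong)
qed

lemma P_sum: "P (\<Sum>i\<in>A. a i *\<^sub>R s i) = (\<Sum>i\<in>A. a i *\<^sub>R s i)"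
  by (simp add: P.sum P.scaleR P_s)

end

section \<open>Permutations of a symmetric basis\<close>

lemma permutes_extending_injection:
  assumes "finite F" "A \<subseteq> F" "f ` A \<subseteq> F" "inj_on f A"
  obtains \<rho> where "\<rho> permutes F" "\<And>x. x \<in> A \<Longrightarrow> \<rho> x = f x"
proof -
  have fin: "finite A" using assms finite_subset by blast
  have "card (F - A) = card (F - f ` A)"
    using assms fin by (simp add: card_Diff_subset card_image)
  then obtain g where g: "bij_betw g (F - A) (F - f ` A)"
    using finite_same_card_bij[of "F - A" "F - f ` A"] assms(1) by auto
  define \<rho> where "\<rho> x = (if x \<in> A then f x else if x \<in> F then g x else x)" for x
  have "bij_betw \<rho> A (f ` A)"
    using assms(4) by (simp add: bij_betw_def \<rho>_def inj_on_def)
  moreover have "bij_betw \<rho> (F - A) (F - f ` A)"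
    using g by (subst bij_betw_cong[where g = g]) (auto simp: \<rho>_def)
  ultimately have "bij_betw \<rho> (A \<union> (F - A)) (f ` A \<union> (F - f ` A))" by (rule bij_betw_combine) auto
  moreover have "A \<union> (F - A) = F" "f ` A \<union> (F - f ` A) = F" using assms by auto
  ultimately have "\<rho> permutes F" using assms(2) by (intro bij_imp_permutes) (auto simp: \<rho>_def)
  then show ?thesis using that by (simp add: \<rho>_def)
qed

locale complemented_symmetric_basis = complemented_basis P s for P :: "'a::banach \<Rightarrow> 'a" and s +
  assumes permuted: "bij \<pi> \<Longrightarrow> summable (\<lambda>n. a n *\<^sub>R s (\<pi> n)) \<longleftrightarrow> summable (\<lambda>n. a n *\<^sub>R s n)"
begin

text \<open>Gliding hump. If permutations of the far indices were not uniformly bounded, there would be successive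
intervals, permutations of each of them, and vectors \<open>y k\<close> supported there with
norm at most \<open>(1/2) ^ k\<close> whose permuted versions have norm 1. The sum of the \<open>y k\<close> is a convergent expansion
which diverges under the permutation that acts on each interval as prescribed.\<close>

lemma eventual_permutation_bound:
  "\<exists>m C. 0 < C \<and> (\<forall>m' \<pi> a. \<pi> permutes {m..<m'} \<longrightarrow>
      norm (\<Sum>i\<in>{m..<m'}. a i *\<^sub>R s (\<pi> i)) \<le> C * norm (\<Sum>i\<in>{m..<m'}. a i *\<^sub>R s i))"
proof (rule ccontr)
  assume contr: "\<not> ?thesis"
  have fail: "\<exists>m' \<pi> a. \<pi> permutes {m..<m'} \<and>
      C * norm (\<Sum>i\<in>{m..<m'}. a i *\<^sub>R s i) < norm (\<Sum>i\<in>{m..<m'}. a i *\<^sub>R s (\<pi> i))"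
    if C: "0 < C" for m C
    using contr C unfolding not_ex de_Morgan_conj not_all not_imp not_le by blast
  have "\<exists>m' \<pi> a. \<pi> permutes {m..<m'} \<and> norm (\<Sum>i\<in>{m..<m'}. a i *\<^sub>R s (\<pi> i)) = 1 \<and>
      norm (\<Sum>i\<in>{m..<m'}. a i *\<^sub>R s i) \<le> (1/2)^k" for m k
  proof -
    obtain m' \<pi> a where f: "\<pi> permutes {m..<m'}"
      "2^k * norm (\<Sum>i\<in>{m..<m'}. a i *\<^sub>R s i) < norm (\<Sum>i\<in>{m..<m'}. a i *\<^sub>R s (\<pi> i))"
      using fail[of "2^k" m] by auto
    define t where "t = norm (\<Sum>i\<in>{m..<m'}. a i *\<^sub>R s (\<pi> i))"
    have t: "0 < t" using f(2) unfolding t_def by (smt (verit) norm_ge_zero zero_le_power mult_nonneg_nonneg)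
    have sc: "(\<Sum>i\<in>{m..<m'}. (a i / t) *\<^sub>R v i) = (1/t) *\<^sub>R (\<Sum>i\<in>{m..<m'}. a i *\<^sub>R v i)" for v :: "nat \<Rightarrow> 'a"
      by (simp add: scaleR_sum_right)
    have "norm (\<Sum>i\<in>{m..<m'}. (a i / t) *\<^sub>R s (\<pi> i)) = 1" unfolding sc using t by (simp add: t_def)
    moreover have "norm (\<Sum>i\<in>{m..<m'}. (a i / t) *\<^sub>R s i) \<le> (1/2)^k"
      unfolding sc using t f(2) unfolding t_def[symmetric] by (simp add: field_simps power_one_over)
    ultimately show ?thesis using f(1) by (intro exI[of _ m'] exI[of _ \<pi>] exI[of _ "\<lambda>i. a i / t"]) auto
  qed
  then have "\<exists>t. case t of (m', \<pi>, a) \<Rightarrow> \<pi> permutes {m..<m'} \<and> norm (\<Sum>i\<in>{m..<m'}. a i *\<^sub>R s (\<pi> i)) = 1 \<and>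
      norm (\<Sum>i\<in>{m..<m'}. a i *\<^sub>R s i) \<le> (1/2)^k" (is "\<exists>t. ?Q m k t") for m k
    by simp
  then have "\<exists>W. \<forall>m k. ?Q m k (W m k)" by (intro choice allI)
  then obtain W where W: "\<And>m k. ?Q m k (W m k)" by blast
  define F where "F m k = fst (W m k)" for m k
  define G where "G m k = fst (snd (W m k))" for m k
  define H where "H m k = snd (snd (W m k))" for m k
  have FGH: "G m k permutes {m..<F m k}"
    "norm (\<Sum>i\<in>{m..<F m k}. H m k i *\<^sub>R s (G m k i)) = 1"
    "norm (\<Sum>i\<in>{m..<F m k}. H m k i *\<^sub>R s i) \<le> (1/2)^k" for m k
    using W[of m k] by (auto simp: F_def G_def H_def split: prod.splits)
  define M where "M = rec_nat 0 (\<lambda>k m. F m k)"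
  have M0: "M 0 = 0" and MS: "M (Suc k) = F (M k) k" for k by (auto simp: M_def)
  define \<pi>k where "\<pi>k k = G (M k) k" for k
  define ak where "ak k = H (M k) k" for k
  have perm: "\<pi>k k permutes {M k..<M (Suc k)}" for k unfolding \<pi>k_def MS by (rule FGH)
  have big: "norm (\<Sum>i\<in>{M k..<M (Suc k)}. ak k i *\<^sub>R s (\<pi>k k i)) = 1" for k unfolding \<pi>k_def ak_def MS by (rule FGH)
  have small: "norm (\<Sum>i\<in>{M k..<M (Suc k)}. ak k i *\<^sub>R s i) \<le> (1/2)^k" for k unfolding ak_def MS by (rule FGH)
  have "M k < M (Suc k)" for k
  proof (rule ccontr)
    assume "\<not> ?thesis"
    then show False using big[of k] by simp
  qed
  then have mono: "strict_mono M" by (rule strict_monoI_Suc)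
  (* The intervals from M k to M (Suc k) partition the natural numbers, and bl i is the one containing i. *)
  define bl where "bl i = (LEAST k. i < M (Suc k))" for i
  have in_bl: "M (bl i) \<le> i \<and> i < M (Suc (bl i))" for i
  proof
    have "i < M (Suc i)" using strict_mono_imp_increasing[OF mono, of "Suc i"] by simp
    then show "i < M (Suc (bl i))" unfolding bl_def by (rule LeastI)
    show "M (bl i) \<le> i"
    proof (cases "bl i")
      case 0 then show ?thesis by (simp add: M0)
    next
      case (Suc k)
      then show ?thesis using not_less_Least[of k "\<lambda>k. i < M (Suc k)"] unfolding bl_def by force
    qed
  qed
  have bl_eq: "bl i = k" if "i \<in> {M k..<M (Suc k)}" for i k
  proof (rule ccontr)
    assume "bl i \<noteq> k"
    then have "Suc (bl i) \<le> k \<or> Suc k \<le> bl i" by auto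
    then have "M (Suc (bl i)) \<le> M k \<or> M (Suc k) \<le> M (bl i)" using mono by (simp add: strict_mono_less_eq)
    then show False using in_bl[of i] that by auto
  qed
  define perm_all where "perm_all i = \<pi>k (bl i) i" for i
  define a where "a i = ak (bl i) i" for i
  have bl_perm_all: "bl (\<pi>k k i) = k" if "i \<in> {M k..<M (Suc k)}" for i k
    using permutes_in_image[OF perm[of k], of i] that by (intro bl_eq) simp
  have in_bl': "i \<in> {M (bl i)..<M (Suc (bl i))}" for i using in_bl[of i] by simp
  have "bij perm_all"
  proof (rule bijI)
    show "inj perm_all"
    proof (rule injI)
      fix i j assume eq: "perm_all i = perm_all j"
      then have "bl i = bl j" unfolding perm_all_def using bl_perm_all[OF in_bl'] by metis
      then show "i = j" using eq permutes_inj[OF perm] unfolding perm_all_def by (metis injD)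
    qed
    show "surj perm_all"
    proof (rule surjI)
      fix j
      let ?i = "inv_into UNIV (\<pi>k (bl j)) j"
      have "?i \<in> {M (bl j)..<M (Suc (bl j))}"
        using permutes_in_image[OF permutes_inv[OF perm[of "bl j"]], of j] in_bl'[of j] by simp
      then have "bl ?i = bl j" by (rule bl_eq)
      then show "perm_all ?i = j" unfolding perm_all_def using permutes_surj[OF perm] by (simp add: surj_f_inv_f)
    qed
  qed
  define y where "y k = (\<Sum>i\<in>{M k..<M (Suc k)}. ak k i *\<^sub>R s i)" for k
  have "summable (\<lambda>k. norm (y k))"
    by (rule summable_comparison_test'[of "\<lambda>k. (1/2::real)^k" 0])
       (use small in \<open>auto simp: y_def summable_geometric\<close>)
  then have y: "y sums (\<Sum>k. y k)" using summable_norm_cancel summable_sums by blast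
  have "coord (\<Sum>k. y k) i = a i" for i
  proof -
    have "(\<lambda>k. coord (y k) i) sums coord (\<Sum>k. y k) i"
      by (rule bounded_linear.sums[OF bounded_linear_coord y])
    moreover have "(\<lambda>k. coord (y k) i) = (\<lambda>k. if k = bl i then a i else 0)"
    proof
      fix k
      have "i \<in> {M k..<M (Suc k)} \<longleftrightarrow> k = bl i" using bl_eq[of i k] in_bl'[of i] by blast
      then show "coord (y k) i = (if k = bl i then a i else 0)"
        unfolding y_def by (subst coord_sum) (auto simp: a_def)
    qed
    ultimately show ?thesis using sums_single[of "bl i" "\<lambda>_. a i"] sums_unique2 by simp
  qed
  then have "(\<lambda>i. a i *\<^sub>R s i) sums P (\<Sum>k. y k)" using coord_sums[of "\<Sum>k. y k"] by simp
  then have "summable (\<lambda>i. a i *\<^sub>R s (perm_all i))" using permuted[OF \<open>bij perm_all\<close>] sums_summable by blast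
  then obtain N0 where N0: "\<And>m n. N0 \<le> m \<Longrightarrow> norm (\<Sum>i\<in>{m..<n}. a i *\<^sub>R s (perm_all i)) < 1"
    unfolding summable_Cauchy by (meson zero_less_one)
  have "norm (\<Sum>i\<in>{M N0..<M (Suc N0)}. a i *\<^sub>R s (perm_all i)) < 1"
    using N0 strict_mono_imp_increasing[OF mono, of N0] by blast
  moreover have "(\<Sum>i\<in>{M N0..<M (Suc N0)}. a i *\<^sub>R s (perm_all i)) = (\<Sum>i\<in>{M N0..<M (Suc N0)}. ak N0 i *\<^sub>R s (\<pi>k N0 i))"
    by (rule sum.cong) (auto simp: a_def perm_all_def bl_eq)
  ultimately show False using big[of N0] by simp
qed

text \<open>Transpositions of far indices compare the norms of the corresponding basis vectors, which bounds all these norms from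
above and away from 0. The lower bound turns the basis constant into a bound for the coordinates.\<close>

lemma seminormalized:
  obtains D where "1 \<le> D" "\<And>i. norm (s i) \<le> D" "\<And>x i. \<bar>coord x i\<bar> \<le> D * norm x"
proof -
  obtain m C where C0: "0 < C" "\<forall>m' \<pi> a. \<pi> permutes {m..<m'} \<longrightarrow>
      norm (\<Sum>i\<in>{m..<m'}. a i *\<^sub>R s (\<pi> i)) \<le> C * norm (\<Sum>i\<in>{m..<m'}. a i *\<^sub>R s i)"
    using eventual_permutation_bound by blast
  note C = C0(1) C0(2)[rule_format]
  have ratio: "norm (s i) \<le> C * norm (s j)" if "m \<le> i" "m \<le> j" for i j
  proof -
    let ?m' = "Suc (max i j)" and ?a = "\<lambda>k. if k = j then 1 else 0 :: real"
    have single: "(\<Sum>k\<in>{m..<?m'}. ?a k *\<^sub>R v k) = v j" for v :: "nat \<Rightarrow> 'a"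
    proof -
      have "(\<Sum>k\<in>{m..<?m'}. ?a k *\<^sub>R v k) = (\<Sum>k\<in>{m..<?m'}. if k = j then v k else 0)"
        by (rule sum.cong) auto
      then show ?thesis using that by simp
    qed
    have "Transposition.transpose i j permutes {m..<?m'}" using that by (intro permutes_swap_id) auto
    from C(2)[OF this, of ?a] show ?thesis
      using single[of "\<lambda>k. s (Transposition.transpose i j k)"] single[of s] by simp
  qed
  define u where "u = (\<Sum>i<m. norm (s i)) + C * norm (s m)"
  define v where "v = (\<Sum>i<m. 1 / norm (s i)) + C / norm (s m)"
  have u: "norm (s i) \<le> u" for i
  proof (cases "i < m")
    case True
    then have "norm (s i) \<le> (\<Sum>i<m. norm (s i))" by (intro member_le_sum) auto
    then show ?thesis using C by (simp add: u_def add_increasing2)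
  next
    case False
    then have "norm (s i) \<le> C * norm (s m)" using ratio by simp
    then show ?thesis by (simp add: u_def add_increasing sum_nonneg)
  qed
  have v: "1 / norm (s i) \<le> v" for i
  proof (cases "i < m")
    case True
    then have "1 / norm (s i) \<le> (\<Sum>i<m. 1 / norm (s i))"
      by (intro member_le_sum[where f = "\<lambda>i. 1 / norm (s i)"]) auto
    then show ?thesis using C by (simp add: v_def add_increasing2)
  next
    case False
    then have "norm (s m) \<le> C * norm (s i)" using ratio by simp
    then have "1 / norm (s i) \<le> C / norm (s m)" using s_nonzero by (simp add: field_simps)
    then show ?thesis by (simp add: v_def add_increasing sum_nonneg)
  qed
  define D where "D = max 1 (max u (2 * basis_const * v))"
  have "\<bar>coord x i\<bar> \<le> D * norm x" for x i
  proof -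
    have "\<bar>coord x i\<bar> \<le> 2 * basis_const * norm x * (1 / norm (s i))"
      using coord_bound[of x i] s_nonzero[of i] by (simp add: field_simps)
    also have "\<dots> \<le> 2 * basis_const * norm x * v" using basis_const(1) by (intro mult_left_mono v) auto
    also have "\<dots> = (2 * basis_const * v) * norm x" by simp
    also have "\<dots> \<le> D * norm x" by (intro mult_right_mono) (auto simp: D_def)
    finally show ?thesis .
  qed
  moreover have "norm (s i) \<le> D" for i using u[of i] by (simp add: D_def)
  ultimately show ?thesis using that[of D] by (simp add: D_def)
qed

text \<open>Given any permutation, at most \<open>2 * m\<close> terms have an index below \<open>m\<close> or are sent below \<open>m\<close>. They are
estimated one by one through the coordinates. On the other terms the permutation agrees with one of a finite
interval beyond \<open>m\<close>, to which the previous bound applies.\<close>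

lemma permutation_bound:
  "\<exists>B>0. \<forall>\<pi> n a. bij \<pi> \<longrightarrow>
    norm (\<Sum>i<n. a i *\<^sub>R s (\<pi> i)) \<le> B * norm (\<Sum>i<n. a i *\<^sub>R s i)"
proof -
  obtain m C where C0: "0 < C" "\<forall>m' \<pi> a. \<pi> permutes {m..<m'} \<longrightarrow>
      norm (\<Sum>i\<in>{m..<m'}. a i *\<^sub>R s (\<pi> i)) \<le> C * norm (\<Sum>i\<in>{m..<m'}. a i *\<^sub>R s i)"
    using eventual_permutation_bound by blast
  note C = C0(1) C0(2)[rule_format]
  obtain D where D: "1 \<le> D" "\<And>i. norm (s i) \<le> D" "\<And>x i. \<bar>coord x i\<bar> \<le> D * norm x"
    using seminormalized by blast
  define L where "L = real (2 * m) * (D * D)"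
  have main: "norm (\<Sum>i<n. a i *\<^sub>R s (\<pi> i)) \<le> (C * (1 + L) + L + 1) * norm (\<Sum>i<n. a i *\<^sub>R s i)"
    if \<pi>: "bij \<pi>" for \<pi> :: "nat \<Rightarrow> nat" and n a
  proof -
    define x where "x = (\<Sum>i<n. a i *\<^sub>R s i)"
    have a_le: "norm (a i *\<^sub>R s j) \<le> D * D * norm x" if "i < n" for i j
    proof -
      have "\<bar>a i\<bar> \<le> D * norm x" using D(3)[of x i] coord_sum[of "{..<n}" a i] that by (simp add: x_def)
      then have "\<bar>a i\<bar> * norm (s j) \<le> D * norm x * D" using D by (intro mult_mono) auto
      then show ?thesis by (simp add: mult_ac)
    qed
    define A where "A = {i. i < n \<and> m \<le> i \<and> m \<le> \<pi> i}"
    define E where "E = {i. i < n \<and> \<not> (m \<le> i \<and> m \<le> \<pi> i)}"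
    have split: "(\<Sum>i<n. f i) = (\<Sum>i\<in>A. f i) + (\<Sum>i\<in>E. f i)" for f :: "nat \<Rightarrow> 'a"
    proof -
      have "{..<n} = A \<union> E" "A \<inter> E = {}" "finite A" "finite E" by (auto simp: A_def E_def)
      then show ?thesis by (simp add: sum.union_disjoint)
    qed
    have "card E \<le> 2 * m"
    proof -
      have "E \<subseteq> {..<m} \<union> inv_into UNIV \<pi> ` {..<m}"
      proof
        fix i assume "i \<in> E"
        then have "i < m \<or> \<pi> i < m" by (auto simp: E_def)
        moreover have "i = inv_into UNIV \<pi> (\<pi> i)" using \<pi> by (simp add: bij_is_inj)
        ultimately show "i \<in> {..<m} \<union> inv_into UNIV \<pi> ` {..<m}" by blast
      qed
      then have "card E \<le> card ({..<m} \<union> inv_into UNIV \<pi> ` {..<m})" by (intro card_mono) auto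
      also have "\<dots> \<le> card {..<m} + card (inv_into UNIV \<pi> ` {..<m})" by (rule card_Un_le)
      also have "\<dots> \<le> m + m" using card_image_le[of "{..<m}" "inv_into UNIV \<pi>"] by simp
      finally show ?thesis by simp
    qed
    have E_le: "norm (\<Sum>i\<in>E. a i *\<^sub>R s (\<rho> i)) \<le> L * norm x" for \<rho>
    proof -
      have "norm (\<Sum>i\<in>E. a i *\<^sub>R s (\<rho> i)) \<le> (\<Sum>i\<in>E. D * D * norm x)"
        by (intro sum_norm_le a_le) (auto simp: E_def)
      also have "\<dots> = real (card E) * (D * D * norm x)" by simp
      also have "\<dots> \<le> real (2 * m) * (D * D * norm x)"
        using \<open>card E \<le> 2 * m\<close> D by (intro mult_right_mono) auto
      finally show ?thesis by (simp add: L_def mult_ac)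
    qed
    define m' where "m' = Suc (Max (insert m (A \<union> \<pi> ` A)))"
    have fin: "finite A" by (simp add: A_def)
    have sub: "A \<subseteq> {m..<m'}" "\<pi> ` A \<subseteq> {m..<m'}"
      using fin by (auto simp: m'_def A_def less_Suc_eq_le intro!: Max_ge)
    obtain \<rho> where \<rho>: "\<rho> permutes {m..<m'}" "\<And>i. i \<in> A \<Longrightarrow> \<rho> i = \<pi> i"
      using permutes_extending_injection[OF _ sub, of ] inj_on_subset[OF bij_is_inj[OF \<pi>], of A] by auto
    have restrict: "(\<Sum>i\<in>{m..<m'}. (if i \<in> A then a i else 0) *\<^sub>R v i) = (\<Sum>i\<in>A. a i *\<^sub>R v i)" for v :: "nat \<Rightarrow> 'a"
      by (rule sum.mono_neutral_cong_right) (use sub in auto)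
    have "norm (\<Sum>i\<in>A. a i *\<^sub>R s (\<rho> i)) \<le> C * norm (\<Sum>i\<in>A. a i *\<^sub>R s i)"
      using C(2)[OF \<rho>(1), of "\<lambda>i. if i \<in> A then a i else 0"] unfolding restrict .
    moreover have "(\<Sum>i\<in>A. a i *\<^sub>R s (\<rho> i)) = (\<Sum>i\<in>A. a i *\<^sub>R s (\<pi> i))" using \<rho>(2) by (intro sum.cong) auto
    moreover have "norm (\<Sum>i\<in>A. a i *\<^sub>R s i) \<le> (1 + L) * norm x"
    proof -
      have eq: "(\<Sum>i\<in>A. a i *\<^sub>R s i) = x - (\<Sum>i\<in>E. a i *\<^sub>R s i)" using split[of "\<lambda>i. a i *\<^sub>R s i"] by (simp add: x_def)
      show ?thesis
        unfolding eq using norm_triangle_ineq4[of x "\<Sum>i\<in>E. a i *\<^sub>R s i"] E_le[of "\<lambda>i. i"] by (simp add: algebra_simps)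
    qed
    then have "C * norm (\<Sum>i\<in>A. a i *\<^sub>R s i) \<le> C * ((1 + L) * norm x)" using C(1) by (intro mult_left_mono) auto
    ultimately have "norm (\<Sum>i\<in>A. a i *\<^sub>R s (\<pi> i)) \<le> C * ((1 + L) * norm x)" by simp
    then have "norm (\<Sum>i<n. a i *\<^sub>R s (\<pi> i)) \<le> C * ((1 + L) * norm x) + L * norm x"
      unfolding split by (intro order_trans[OF norm_triangle_ineq] add_mono E_le)
    also have "\<dots> \<le> (C * (1 + L) + L + 1) * norm x" by (simp add: algebra_simps)
    finally show ?thesis unfolding x_def .
  qed
  have "0 < C * (1 + L) + L + 1"
    using C(1) D(1) by (simp add: L_def add_nonneg_pos)
  then show ?thesis using main by blast
qed

definition permuted_sum :: "(nat \<Rightarrow> nat) \<Rightarrow> 'a \<Rightarrow> 'a" where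
  "permuted_sum \<pi> x = (\<Sum>n. coord x n *\<^sub>R s (\<pi> n))"

definition perm_op :: "(nat \<Rightarrow> nat) \<Rightarrow> 'a \<Rightarrow> 'a" where
  "perm_op \<pi> x = x - P x + permuted_sum \<pi> x"

lemma permuted_sums: "bij \<pi> \<Longrightarrow> (\<lambda>n. coord x n *\<^sub>R s (\<pi> n)) sums permuted_sum \<pi> x"
  unfolding permuted_sum_def using permuted coord_sums sums_summable summable_sums by blast

lemma P_permuted_sum: "bij \<pi> \<Longrightarrow> P (permuted_sum \<pi> x) = permuted_sum \<pi> x"
  using P.sums[OF permuted_sums[of \<pi> x]] permuted_sums[of \<pi> x] sums_unique2
  by (simp add: P.scaleR P_s)

lemma linear_perm_op: "bij \<pi> \<Longrightarrow> linear (perm_op \<pi>)"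
proof (rule linearI)
  assume \<pi>: "bij \<pi>"
  show "perm_op \<pi> (x + y) = perm_op \<pi> x + perm_op \<pi> y" for x y
    using sums_unique2[OF permuted_sums[OF \<pi>, of "x + y"], of "permuted_sum \<pi> x + permuted_sum \<pi> y"]
      sums_add[OF permuted_sums[OF \<pi>, of x] permuted_sums[OF \<pi>, of y]]
    by (simp add: perm_op_def P.add coord_add scaleR_add_left)
  show "perm_op \<pi> (c *\<^sub>R x) = c *\<^sub>R perm_op \<pi> x" for c x
    using sums_unique2[OF permuted_sums[OF \<pi>, of "c *\<^sub>R x"], of "c *\<^sub>R permuted_sum \<pi> x"]
      sums_scaleR_right[OF permuted_sums[OF \<pi>, of x], of c]
    by (simp add: perm_op_def P.scaleR coord_scale scaleR_diff_right scaleR_add_right)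
qed

lemma coord_permuted_sum: "bij \<pi> \<Longrightarrow> coord (permuted_sum \<pi> x) (\<pi> i) = coord x i"
proof -
  assume \<pi>: "bij \<pi>"
  have "(\<lambda>n. coord (coord x n *\<^sub>R s (\<pi> n)) (\<pi> i)) sums coord (permuted_sum \<pi> x) (\<pi> i)"
    by (rule bounded_linear.sums[OF bounded_linear_coord permuted_sums[OF \<pi>]])
  moreover have "(\<lambda>n. coord (coord x n *\<^sub>R s (\<pi> n)) (\<pi> i)) = (\<lambda>n. if n = i then coord x n else 0)"
    using bij_is_inj[OF \<pi>] by (auto simp: coord_scale coord_s inj_eq)
  ultimately show ?thesis using sums_single[of i "coord x"] sums_unique2 by simp
qed

lemma coord_perm_op: "bij \<pi> \<Longrightarrow> coord (perm_op \<pi> x) (\<pi> i) = coord x i"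
  by (simp add: perm_op_def coord_add linear_diff[OF linear_coord] coord_P coord_permuted_sum)

lemma P_perm_op: "bij \<pi> \<Longrightarrow> P (perm_op \<pi> x) = permuted_sum \<pi> x"
  by (simp add: perm_op_def P.add P.diff P_idem P_permuted_sum)

lemma perm_op_comp:
  assumes "bij \<pi>" "bij \<rho>"
  shows "perm_op \<pi> (perm_op \<rho> x) = perm_op (\<pi> \<circ> \<rho>) x"
proof -
  have b: "bij (\<pi> \<circ> \<rho>)" using assms bij_comp by blast
  have "coord (permuted_sum \<pi> (perm_op \<rho> x)) j = coord (permuted_sum (\<pi> \<circ> \<rho>) x) j" for j
  proof -
    obtain i where i: "j = \<pi> (\<rho> i)" using assms by (metis bij_pointE)
    show ?thesis
      using coord_permuted_sum[OF assms(1), of "perm_op \<rho> x" "\<rho> i"] coord_perm_op[OF assms(2), of x i]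
        coord_permuted_sum[OF b, of x i] i by simp
  qed
  then have "permuted_sum \<pi> (perm_op \<rho> x) = permuted_sum (\<pi> \<circ> \<rho>) x"
    using P_eqI[of "permuted_sum \<pi> (perm_op \<rho> x)" "permuted_sum (\<pi> \<circ> \<rho>) x"] P_permuted_sum assms b by auto
  moreover have "perm_op \<rho> x - P (perm_op \<rho> x) = x - P x"
    using P_perm_op[OF assms(2)] by (simp add: perm_op_def)
  ultimately show ?thesis by (simp add: perm_op_def[of \<pi>] perm_op_def[of "\<pi> \<circ> \<rho>"])
qed

lemma perm_op_id: "perm_op id x = x"
  using sums_unique[OF coord_sums[of x]] by (simp add: perm_op_def permuted_sum_def)

lemma perm_op_s: "bij \<pi> \<Longrightarrow> perm_op \<pi> (s n) = s (\<pi> n)"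
proof -
  assume \<pi>: "bij \<pi>"
  have "(\<lambda>k. coord (s n) k *\<^sub>R s (\<pi> k)) = (\<lambda>k. if k = n then s (\<pi> k) else 0)" by (auto simp: coord_s)
  then have "permuted_sum \<pi> (s n) = s (\<pi> n)"
    using permuted_sums[OF \<pi>, of "s n"] sums_single[of n "\<lambda>k. s (\<pi> k)"] sums_unique2 by metis
  then show ?thesis by (simp add: perm_op_def P_s)
qed

lemma perm_op_complement: "P x = 0 \<Longrightarrow> perm_op \<pi> x = x"
  using coord_unique[of "\<lambda>_. 0" x] by (simp add: perm_op_def permuted_sum_def)

lemma perm_op_bound:
  obtains M where "0 < M" "\<And>\<pi> x. bij \<pi> \<Longrightarrow> norm (perm_op \<pi> x) \<le> M * norm x"
proof -
  obtain B where B0: "0 < B"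
    "\<forall>\<pi> n a. bij \<pi> \<longrightarrow> norm (\<Sum>i<n. a i *\<^sub>R s (\<pi> i)) \<le> B * norm (\<Sum>i<n. a i *\<^sub>R s i)"
    using permutation_bound by blast
  note B = B0(1) B0(2)[rule_format]
  obtain L where L: "0 < L" "\<And>x. norm (P x) \<le> norm x * L" using P.pos_bounded by blast
  have "norm (perm_op \<pi> x) \<le> (1 + L + B * L) * norm x" if \<pi>: "bij \<pi>" for \<pi> x
  proof -
    have "norm (permuted_sum \<pi> x) \<le> B * norm (P x)"
    proof (rule LIMSEQ_le)
      show "(\<lambda>n. norm (\<Sum>i<n. coord x i *\<^sub>R s (\<pi> i))) \<longlonglongrightarrow> norm (permuted_sum \<pi> x)"
        using permuted_sums[OF \<pi>, of x] unfolding sums_def by (rule tendsto_norm)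
      show "(\<lambda>n. B * norm (\<Sum>i<n. coord x i *\<^sub>R s i)) \<longlonglongrightarrow> B * norm (P x)"
        using coord_sums[of x] unfolding sums_def by (intro tendsto_mult_left tendsto_norm)
    qed (use B(2)[OF \<pi>] in auto)
    also have "\<dots> \<le> B * (norm x * L)" using B(1) L by (intro mult_left_mono) auto
    finally have "norm (permuted_sum \<pi> x) \<le> B * (norm x * L)" .
    moreover have "norm (perm_op \<pi> x) \<le> norm x + norm (P x) + norm (permuted_sum \<pi> x)"
      unfolding perm_op_def using norm_triangle_ineq[of "x - P x" "permuted_sum \<pi> x"] norm_triangle_ineq4[of x "P x"] by linarith
    ultimately show ?thesis using L(2)[of x] by (simp add: algebra_simps)
  qed
  moreover have "0 < 1 + L + B * L" using L B by (simp add: add_pos_pos)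
  ultimately show ?thesis using that by blast
qed

end

section \<open>Countable groups permuting the basis\<close>

context complemented_symmetric_basis
begin

text \<open>Up to the two coordinates \<open>j\<close> and \<open>k\<close>, the vector \<open>P x\<close> is a limit of combinations of the remaining basis
vectors, and the rest of \<open>x\<close> is covered by \<open>W\<close>.\<close>

lemma dense_if_complement_dense:
  assumes E: "\<And>i. i \<noteq> j \<Longrightarrow> i \<noteq> k \<Longrightarrow> s i \<in> E" and D: "closure D = UNIV"
    and W: "\<And>x. x \<in> D \<Longrightarrow> x - P x + coord x j *\<^sub>R s j + coord x k *\<^sub>R s k \<in> span W" and "j \<noteq> k"
  shows "closure (span (E \<union> W)) = UNIV"
proof -
  have "x \<in> closure (span (E \<union> W))" if x: "x \<in> D" for x
  proof -
    define b where "b i = (if i = j \<or> i = k then 0 else coord x i *\<^sub>R s i)" for i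
    have "b i \<in> span (E \<union> W)" for i
      using E[of i] by (cases "i = j \<or> i = k") (auto simp: b_def span_zero intro!: span_scale intro: span_base)
    then have partial: "(\<Sum>i<n. b i) \<in> span (E \<union> W)" for n by (intro span_sum)
    define v where "v = x - P x + coord x j *\<^sub>R s j + coord x k *\<^sub>R s k"
    have v: "v \<in> span (E \<union> W)" using W[OF x] span_mono[of W "E \<union> W"] by (auto simp: v_def)
    have "(\<lambda>n. \<Sum>i<n. b i) \<longlonglongrightarrow> P x - coord x j *\<^sub>R s j - coord x k *\<^sub>R s k"
    proof -
      have "(\<lambda>i. coord x i *\<^sub>R s i - (if i = j then coord x i *\<^sub>R s i else 0) - (if i = k then coord x i *\<^sub>R s i else 0))
          sums (P x - coord x j *\<^sub>R s j - coord x k *\<^sub>R s k)"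
        by (intro sums_diff coord_sums sums_single)
      moreover have "(\<lambda>i. coord x i *\<^sub>R s i - (if i = j then coord x i *\<^sub>R s i else 0) - (if i = k then coord x i *\<^sub>R s i else 0)) = b"
        using \<open>j \<noteq> k\<close> by (auto simp: b_def)
      ultimately show ?thesis by (simp add: sums_def)
    qed
    then have "(\<lambda>n. (\<Sum>i<n. b i) + v) \<longlonglongrightarrow> P x - coord x j *\<^sub>R s j - coord x k *\<^sub>R s k + v"
      by (intro tendsto_add tendsto_const)
    moreover have "P x - coord x j *\<^sub>R s j - coord x k *\<^sub>R s k + v = x" by (simp add: v_def)
    ultimately have "(\<lambda>n. (\<Sum>i<n. b i) + v) \<longlonglongrightarrow> x" by simp
    moreover have "(\<Sum>i<n. b i) + v \<in> span (E \<union> W)" for n using partial v by (intro span_add)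
    ultimately show ?thesis unfolding closure_sequential by (intro exI[of _ "\<lambda>n. (\<Sum>i<n. b i) + v"] conjI allI)
  qed
  then have "closure D \<subseteq> closure (span (E \<union> W))" by (intro closure_minimal) auto
  then show ?thesis using D by auto
qed

lemma countable_group_representable:
  fixes G :: "('g, 'm) monoid_scheme"
  assumes "group G" and cG: "countable (carrier G)" and sep: "separable_space (euclidean :: 'a topology)"
  shows "representable (sign_img \<times>\<times> G) TYPE('a)"
proof -
  interpret G: group G by fact
  (* I is the new index set of the basis, and ix and b translate between I and the natural numbers.
     The two booleans index the vectors on which G acts trivially. *)
  define I where "I = carrier G \<times> (UNIV :: nat set) <+> (UNIV :: bool set)"
  have cI: "countable I" unfolding I_def using cG by (intro countable_Plus countable_SIGMA) auto
  have iI: "infinite I"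
  proof
    assume "finite I"
    then have "finite (range (\<lambda>n::nat. (Inl (\<one>\<^bsub>G\<^esub>, n) :: ('g \<times> nat) + bool)))"
      by (rule finite_subset[rotated]) (auto simp: I_def)
    then show False using finite_imageD[of "\<lambda>n::nat. (Inl (\<one>\<^bsub>G\<^esub>, n) :: ('g \<times> nat) + bool)" UNIV] by (auto simp: inj_on_def)
  qed
  define b where "b = from_nat_into I"
  define ix where "ix = to_nat_on I"
  have b_ix: "i \<in> I \<Longrightarrow> b (ix i) = i" for i unfolding b_def ix_def using cI by simp
  have ix_b: "ix (b n) = n" for n unfolding b_def ix_def using cI iI by simp
  have b_I: "b n \<in> I" for n unfolding b_def using iI by (intro from_nat_into) auto
  have ix_inj: "i \<in> I \<Longrightarrow> j \<in> I \<Longrightarrow> ix i = ix j \<longleftrightarrow> i = j" for i j using b_ix by metis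
  have InlI: "Inl (g, n) \<in> I \<longleftrightarrow> g \<in> carrier G" for g n by (auto simp: I_def)
  have InrI: "Inr c \<in> I" for c by (auto simp: I_def)
  define act where "act g = map_sum (\<lambda>(h, n :: nat). (g \<otimes>\<^bsub>G\<^esub> h, n)) (id :: bool \<Rightarrow> bool)" for g
  have act_I: "act g i \<in> I" if "g \<in> carrier G" "i \<in> I" for g i
    using that by (auto simp: act_def I_def)
  have act_mult: "act g (act h i) = act (g \<otimes>\<^bsub>G\<^esub> h) i" if "g \<in> carrier G" "h \<in> carrier G" "i \<in> I" for g h i
    using that by (auto simp: act_def I_def G.m_assoc)
  have act_one: "act \<one>\<^bsub>G\<^esub> i = i" if "i \<in> I" for i using that by (auto simp: act_def I_def)
  define perm where "perm g n = ix (act g (b n))" for g n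
  have perm_ix: "perm g (ix i) = ix (act g i)" if "i \<in> I" for g i using that by (simp add: perm_def b_ix)
  have perm_mult: "perm g \<circ> perm h = perm (g \<otimes>\<^bsub>G\<^esub> h)" if "g \<in> carrier G" "h \<in> carrier G" for g h
    using that by (auto simp: perm_def fun_eq_iff b_ix act_I act_mult b_I)
  have perm_one: "perm \<one>\<^bsub>G\<^esub> = id" by (auto simp: perm_def fun_eq_iff act_one b_I ix_b)
  have bij: "bij (perm g)" if "g \<in> carrier G" for g
    by (rule o_bij[of "perm (inv\<^bsub>G\<^esub> g)"]) (use that in \<open>auto simp: perm_mult perm_one\<close>)
  define jp where "jp = ix (Inr True)"
  define jq where "jq = ix (Inr False)"
  have jpq: "jp \<noteq> jq" unfolding jp_def jq_def using ix_inj InrI by simp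
  have perm_jpq: "perm g jp = jp" "perm g jq = jq" for g
    unfolding jp_def jq_def by (simp_all add: perm_ix InrI act_def)
  have ix_Inl: "ix (Inl (g, n)) \<noteq> jp" "ix (Inl (g, n)) \<noteq> jq" if "g \<in> carrier G" for g n
    unfolding jp_def jq_def using ix_inj InrI InlI that by simp_all
  obtain D where D: "1 \<le> D" "\<And>i. norm (s i) \<le> D" "\<And>x i. \<bar>coord x i\<bar> \<le> D * norm x"
    using seminormalized by blast
  obtain M where M: "0 < M" "\<And>\<pi> x. bij \<pi> \<Longrightarrow> norm (perm_op \<pi> x) \<le> M * norm x"
    using perm_op_bound by blast
  obtain Q where Q: "countable Q" "closure Q = (UNIV :: 'a set)"
    using sep unfolding separable_space_def by auto
  have "Q \<noteq> {}" using Q(2) by auto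
  define y where "y x = x - P x + coord x jp *\<^sub>R s jp + coord x jq *\<^sub>R s jq" for x
  (* The part y x of x is invariant under G, since permutations fix the kernel of P and both extra
     basis vectors. Rescaled, these parts for x in a dense sequence are the vectors w n. *)
  define w where "w n = (1 / (40 * D * (1 + norm (y (from_nat_into Q n))))) *\<^sub>R y (from_nat_into Q n)" for n
  have cy: "coord (y x) n = 0" if "n \<noteq> jp" "n \<noteq> jq" for x n
    using that by (simp add: y_def coord_add coord_scale coord_s linear_diff[OF linear_coord] coord_P)
  have Ty: "perm_op (perm g) (y x) = y x" if "g \<in> carrier G" for g x
  proof -
    have "P (x - P x) = 0" by (simp add: P.diff P_idem)
    then show ?thesis unfolding y_def
      using that bij by (simp add: linear_add[OF linear_perm_op] linear_scale[OF linear_perm_op] perm_op_complement perm_op_s perm_jpq)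
  qed
  define colour where "colour c = 4/5 + 1/10 / (1 + real (to_nat_on (carrier G \<times> (UNIV :: nat set)) c))" for c
  interpret group_spikes G "\<lambda>g. perm_op (perm g)" "\<lambda>i. s (ix (Inl i))" "\<lambda>i x. coord x (ix (Inl i))" "s jp" "s jq" w colour M D "1 / (2 * D)"
  proof (intro group_spikes.intro group_spikes_axioms.intro)
    show "group G" by fact
  next
    fix g h x n
    assume g: "g \<in> carrier G"
    show "linear (perm_op (perm g))" by (rule linear_perm_op[OF bij[OF g]])
    show "norm (perm_op (perm g) x) \<le> M * norm x" using M(2) bij g by blast
    show "perm_op (perm g) (s jp) = s jp \<and> perm_op (perm g) (s jq) = s jq" using bij[OF g] by (simp add: perm_op_s perm_jpq)
    show "perm_op (perm g) (w n) = w n" using Ty[OF g] by (simp add: w_def linear_scale[OF linear_perm_op] bij g)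
    assume h: "h \<in> carrier G"
    show "perm_op (perm g) (perm_op (perm h) x) = perm_op (perm (g \<otimes>\<^bsub>G\<^esub> h)) x"
      using g h by (simp add: perm_op_comp bij perm_mult)
    show "perm_op (perm g) (s (ix (Inl (h, n)))) = s (ix (Inl (g \<otimes>\<^bsub>G\<^esub> h, n)))"
      using g h by (simp add: perm_op_s bij perm_ix InlI act_def)
  next
    show "perm_op (perm \<one>\<^bsub>G\<^esub>) x = x" for x using perm_op_id perm_one by simp
    show "0 < M" "1 \<le> D" by fact+
    show "norm (s (ix (Inl i))) \<le> D" for i by (rule D)
    show "\<bar>coord x (ix (Inl i))\<bar> \<le> D * norm x" for i x by (rule D)
    show "linear (\<lambda>x. coord x (ix (Inl i)))" for i by (rule linear_coord)
    show "coord (s (ix (Inl j))) (ix (Inl i)) = (if i = j then 1 else 0)"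
      if "i \<in> carrier G \<times> UNIV" "j \<in> carrier G \<times> UNIV" for i j
      using that by (auto simp: coord_s ix_inj InlI)
    show "coord (s jp) (ix (Inl i)) = 0 \<and> coord (s jq) (ix (Inl i)) = 0" if "i \<in> carrier G \<times> UNIV" for i
      using that ix_Inl by (cases i) (auto simp: coord_s)
    show "0 < 1 / (2 * D)" using D(1) by simp
    show "1 / (2 * D) \<le> norm (a *\<^sub>R s jp + c *\<^sub>R s jq)" if "a\<^sup>2 + c\<^sup>2 = 1" for a c
    proof (rule ccontr)
      let ?v = "a *\<^sub>R s jp + c *\<^sub>R s jq"
      assume "\<not> ?thesis"
      then have v: "D * norm ?v < 1/2" using D(1) by (simp add: field_simps)
      have "coord ?v jp = a" "coord ?v jq = c" using jpq by (auto simp: coord_add coord_scale coord_s)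
      then have "\<bar>a\<bar> < 1/2" "\<bar>c\<bar> < 1/2" using D(3)[of ?v jp] D(3)[of ?v jq] v by auto
      then have "a\<^sup>2 \<le> (1/2)\<^sup>2" "c\<^sup>2 \<le> (1/2)\<^sup>2" by (auto intro: power2_le_iff_abs_le[THEN iffD2])
      then show False using that by (simp add: power2_eq_square)
    qed
    show "coord (w n) (ix (Inl i)) = 0" if "i \<in> carrier G \<times> UNIV" for i n
      using that ix_Inl by (cases i) (auto simp: w_def coord_scale cy)
    show "norm (w n) \<le> 1 / (40 * D)" for n
    proof -
      let ?y = "y (from_nat_into Q n)"
      have "norm ?y / (1 + norm ?y) \<le> 1" by (simp add: divide_le_eq_1 add_nonneg_pos add_pos_nonneg)
      then have "1 / (40 * D) * (norm ?y / (1 + norm ?y)) \<le> 1 / (40 * D) * 1" using D(1) by (intro mult_left_mono) auto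
      moreover have "norm (w n) = 1 / (40 * D) * (norm ?y / (1 + norm ?y))" using D(1) by (simp add: w_def)
      ultimately show ?thesis by simp
    qed
    show "closure (span ((\<lambda>i. s (ix (Inl i))) ` (carrier G \<times> UNIV) \<union> range w)) = UNIV"
    proof (rule dense_if_complement_dense[OF _ Q(2) _ jpq])
      fix i assume i: "i \<noteq> jp" "i \<noteq> jq"
      obtain c where "b i = Inl c" "c \<in> carrier G \<times> UNIV"
      proof (cases "b i")
        case (Inl c) then show ?thesis using that b_I[of i] by (auto simp: I_def)
      next
        case (Inr c)
        then have "i = ix (Inr c)" using ix_b[of i] by simp
        then show ?thesis using i unfolding jp_def jq_def by (cases c) auto
      qed
      then show "s i \<in> (\<lambda>i. s (ix (Inl i))) ` (carrier G \<times> UNIV)" using ix_b[of i] by (metis imageI)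
    next
      fix x assume "x \<in> Q"
      then obtain n where n: "x = from_nat_into Q n" using Q(1) by (metis from_nat_into_to_nat_on)
      have "1 + norm (y x) \<noteq> 0" using norm_ge_zero[of "y x"] by linarith
      then have "y x = (40 * D * (1 + norm (y x))) *\<^sub>R w n" using D(1) by (simp add: w_def n[symmetric])
      then have "y x \<in> span (range w)" by (metis span_scale span_base rangeI)
      then show "x - P x + coord x jp *\<^sub>R s jp + coord x jq *\<^sub>R s jq \<in> span (range w)" by (simp add: y_def)
    qed
    show "4/5 \<le> colour c \<and> colour c \<le> 9/10" for c
    proof -
      have "1/10 / (1 + real (to_nat_on (carrier G \<times> (UNIV :: nat set)) c)) \<le> 1/10 / 1" by (intro divide_left_mono) auto
      then show ?thesis unfolding colour_def by simp
    qed
    have "countable (carrier G \<times> (UNIV :: nat set))" using cG by (intro countable_SIGMA) auto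
    then have inj: "inj_on (to_nat_on (carrier G \<times> (UNIV :: nat set))) (carrier G \<times> UNIV)" by (rule inj_on_to_nat_on)
    show "inj_on colour (carrier G \<times> UNIV)"
    proof (rule inj_onI)
      fix c d assume cd: "c \<in> carrier G \<times> UNIV" "d \<in> carrier G \<times> UNIV" "colour c = colour d"
      have "to_nat_on (carrier G \<times> (UNIV :: nat set)) c = to_nat_on (carrier G \<times> (UNIV :: nat set)) d"
        using cd(3) unfolding colour_def by (simp add: frac_eq_eq)
      then show "c = d" using inj cd by (auto dest: inj_onD)
    qed
  qed
  show ?thesis by (rule signed_group_representable)
qed

end

theorem theorem16:
  fixes G :: "('g, 'm) monoid_scheme"
  assumes "group G" and "countable (carrier G)"
    and "infinite_dimensional TYPE('a::banach)"
    and "separable_space (euclidean :: 'a topology)"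
    and "\<exists>(Y :: 'a set) s. complemented_subspace Y \<and> symmetric_basis s Y"
  shows "representable (sign_img \<times>\<times> G) TYPE('a)"
proof -
  obtain Y :: "'a set" and s P where Y: "bounded_linear P" "P \<circ> P = P" "range P = Y" and s: "symmetric_basis s Y"
    using assms(5) unfolding complemented_subspace_def by blast
  interpret complemented_symmetric_basis P s
  proof (intro complemented_symmetric_basis.intro complemented_basis.intro complemented_symmetric_basis_axioms.intro)
    show "bounded_linear P" by fact
    show "P (P x) = P x" for x using Y(2) by (metis comp_apply)
    show "schauder_basis s (range P)" using s Y(3) unfolding symmetric_basis_def by simp
    show "summable (\<lambda>n. a n *\<^sub>R s (\<pi> n)) \<longleftrightarrow> summable (\<lambda>n. a n *\<^sub>R s n)" if "bij \<pi>" for \<pi> a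
      using s that unfolding symmetric_basis_def equivalent_sequences_def comp_def by blast
  qed
  show ?thesis using assms by (intro countable_group_representable)
qed

end
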